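(* For any $y\in\mathbb{R}^{d-1}$, the matrix $C(y)=\lim_{n\to\infty}\beta^n\underline{B}^{(n)}(y)$ has rank $\leqslant 1$, and can be represented as $C(y)=|c(y)\rangle\langle u|$, i.e. as the product of a column vector $c(y)\in\mathbb{C}^N$ with the row vector $u$. Moreover, with $f_i=\check{1_{W_i}}$ and $f(y)=(f_1(y),\ldots,f_N(y))^T$, one has $f(y)=\eta\,c(y)$, where $\eta>0$ is the number with $\operatorname{vol}(W_i)=\eta\,v_i$ for all $1\leqslant i\leqslant N$, together with $c(y)=C(y)\,v$.
   Context: Setting. Let $\varrho$ be a primitive substitution on the alphabet $\{a_1,\ldots,a_N\}$ with substitution matrix $M$, where $M_{ij}$ is the number of letters $a_i$ in $\varrho(a_j)$. Let $\lambda$ be the Perron–Frobenius (PF) eigenvalue of $M$, assumed to be a Pisot–Vijayaraghavan (PV) unit of degree $d\leqslant N$: $\lambda>1$ is an algebraic integer and a unit, and all its other algebraic conjugates have modulus $<1$. The characteristic polynomial of $M$ need not be irreducible. Let $v=(v_1,\ldots,v_N)^T$ and $u=(u_1,\ldots,u_N)$ be the strictly positive right and left PF eigenvectors of $M$, normalised by $\sum_i v_i=1$ and $\sum_i u_iv_i=1$. Geometric realisation. Letter $a_i$ is realised as an interval (tile) of length $\ell_i=c_0\,u_i$ with a constant $c_0>0$ chosen such that all control points (left endpoints of tiles), relative to one of them placed at $0$, lie in $\mathbb{Z}[\lambda]$, but in no proper $\lambda$-invariant submodule of it. For $1\leqslant i,j\leqslant N$, $T_{ij}\subset\mathbb{Z}[\lambda]$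 is the finite set of positions of the left endpoints of the tiles of type $a_i$ in the supertile $\varrho(a_j)$ (of length $\lambda\ell_j$, left endpoint at $0$), so $\operatorname{card}(T_{ij})=M_{ij}$. Star map. Let $\kappa_1=\mathrm{id},\kappa_2,\ldots,\kappa_r$ be the real embeddings of $\mathbb{Q}(\lambda)$ and $\sigma_1,\overline{\sigma_1},\ldots,\sigma_s,\overline{\sigma_s}$ the complex ones, $d=r+2s$. For $x\in\mathbb{Z}[\lambda]$, put $x^\star=(\kappa_2(x),\ldots,\kappa_r(x),\operatorname{Re}\sigma_1(x),\operatorname{Im}\sigma_1(x),\ldots,\operatorname{Re}\sigma_s(x),\operatorname{Im}\sigma_s(x))\in\mathbb{R}^{d-1}$. Let $Q$ be the linear map on $\mathbb{R}^{d-1}$ with $(\lambda x)^\star=Qx^\star$, i.e. $Q=\operatorname{diag}(\kappa_2(\lambda),\ldots,\kappa_r(\lambda))\oplus\bigoplus_{i=1}^s\begin{pmatrix}\operatorname{Re}\sigma_i(\lambda)&-\operatorname{Im}\sigma_i(\lambda)\\ \operatorname{Im}\sigma_i(\lambda)&\operatorname{Re}\sigma_i(\lambda)\end{pmatrix}$. Put $R=Q^T$ and $\beta=|\det(R)|=\lambda^{-1}$. Windows. $(W_1,\ldots,W_N)$ is the unique $N$-tuple of non-empty compact subsets of $\mathbb{R}^{d-1}$ with $W_i=\bigcup_{j=1}^N\bigcup_{t\in T_{ij}}(QW_j+t^\star)$ for $1\leqslant i\leqslant N$. It is known that there is a number $\eta>0$ with $\operatorname{vol}(W_i)=\eta v_i$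 for all $i$ (Lebesgue measure). $1_K$ is the characteristic function of $K$, and $\check{g}(y)=\int_{\mathbb{R}^{d-1}}e^{2\pi\mathrm{i}\langle x|y\rangle}g(x)\,\mathrm{d}x$ is the inverse Fourier transform. Internal cocycle. The internal Fourier matrix is $\underline{B}(y)\in\mathrm{Mat}(N,\mathbb{C})$, $y\in\mathbb{R}^{d-1}$, with $\underline{B}_{ij}(y)=\sum_{x\in T_{ij}}e^{2\pi\mathrm{i}\langle x^\star|y\rangle}$, and $\underline{B}^{(n)}(y)=\underline{B}(y)\,\underline{B}(Ry)\cdots\underline{B}(R^{n-1}y)$ for $n\in\mathbb{N}$. The limit $C(y)=\lim_{n\to\infty}\beta^n\underline{B}^{(n)}(y)$ exists for every $y\in\mathbb{R}^{d-1}$. *)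

theory Defs
  imports
    "HOL-Analysis.Analysis"
    "HOL-Computational_Algebra.Polynomial_Factorial"
    "HOL-Library.Sublist"
begin

text \<open>The alphabet is a finite type \<open>'n\<close>, so \<open>N = CARD('n)\<close>. A substitution is given by the
  images of the letters, as words. Since \<open>\<lambda>\<close> is a reserved symbol, the inflation multiplier
  is called \<open>lam\<close>.\<close>

definition subst_word :: "('n \<Rightarrow> 'n list) \<Rightarrow> 'n list \<Rightarrow> 'n list" where
  "subst_word \<rho> w = concat (map \<rho> w)"

text \<open>The exponent has to be positive: otherwise a one-letter alphabet with an empty image
  would qualify. In particular, all images are nonempty words.\<close>

definition primitive_subst :: "('n \<Rightarrow> 'n list) \<Rightarrow> bool" where
  "primitive_subst \<rho> \<longleftrightarrow> (\<exists>k>0. \<forall>i j. i \<in> set ((subst_word \<rho> ^^ k) [j]))"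

definition subst_matrix :: "('n::finite \<Rightarrow> 'n list) \<Rightarrow> real^'n^'n" where
  "subst_matrix \<rho> = (\<chi> i j. real (count_list (\<rho> j) i))"

definition legal_word :: "('n \<Rightarrow> 'n list) \<Rightarrow> 'n list \<Rightarrow> bool" where
  "legal_word \<rho> x \<longleftrightarrow> (\<exists>k a. sublist x ((subst_word \<rho> ^^ k) [a]))"

definition subst_hull :: "('n \<Rightarrow> 'n list) \<Rightarrow> (int \<Rightarrow> 'n) set" where
  "subst_hull \<rho> = {w. \<forall>m n. legal_word \<rho> (map w [m..n])}"

definition complexify_mat :: "real^'m^'n \<Rightarrow> complex^'m^'n" where
  "complexify_mat A = (\<chi> i j. complex_of_real (A $ i $ j))"

definition complexify_vec :: "real^'n \<Rightarrow> complex^'n" where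
  "complexify_vec x = (\<chi> i. complex_of_real (x $ i))"

definition is_pf_eigenvalue :: "real^'n^'n \<Rightarrow> real \<Rightarrow> bool" where
  "is_pf_eigenvalue M lam \<longleftrightarrow>
     (\<exists>x. x \<noteq> 0 \<and> M *v x = lam *s x) \<and>
     (\<forall>\<mu> z. z \<noteq> 0 \<longrightarrow> complexify_mat M *v z = \<mu> *s z \<longrightarrow> cmod \<mu> \<le> lam)"

text \<open>The following two notions are only meaningful for algebraic numbers.\<close>

definition min_poly :: "real \<Rightarrow> rat poly" where
  "min_poly x = (THE p. lead_coeff p = 1 \<and> irreducible p \<and> poly (map_poly of_rat p) x = 0)"

definition alg_conjugates :: "real \<Rightarrow> complex set" where
  "alg_conjugates x = {z. poly (map_poly of_rat (min_poly x)) z = 0}"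

definition pv_unit :: "real \<Rightarrow> bool" where
  "pv_unit lam \<longleftrightarrow> lam > 1 \<and> algebraic_int lam \<and> algebraic_int (inverse lam) \<and>
     (\<forall>z \<in> alg_conjugates lam. z \<noteq> complex_of_real lam \<longrightarrow> cmod z < 1)"

definition int_adjoin :: "real \<Rightarrow> real set" where
  "int_adjoin lam = {poly (map_poly of_int p) lam | p :: int poly. True}"

text \<open>For algebraic \<open>lam\<close>, the ring of rational polynomial expressions is already the field
  generated by \<open>lam\<close>.\<close>

definition rat_adjoin :: "real \<Rightarrow> real set" where
  "rat_adjoin lam = {poly (map_poly of_rat p) lam | p :: rat poly. True}"

text \<open>Embeddings are taken to be extensional, so that they are determined by their values on
  the field and can be counted.\<close>

definition field_embedding :: "real set \<Rightarrow> (real \<Rightarrow> 'b::field) \<Rightarrow> bool" where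
  "field_embedding K \<phi> \<longleftrightarrow> \<phi> \<in> extensional K \<and> \<phi> 1 = 1 \<and>
     (\<forall>x\<in>K. \<forall>y\<in>K. \<phi> (x + y) = \<phi> x + \<phi> y \<and> \<phi> (x * y) = \<phi> x * \<phi> y)"

definition real_embeddings :: "real set \<Rightarrow> (real \<Rightarrow> real) set" where
  "real_embeddings K = {\<phi>. field_embedding K \<phi>}"

definition nonreal_embeddings :: "real set \<Rightarrow> (real \<Rightarrow> complex) set" where
  "nonreal_embeddings K = {\<phi>. field_embedding K \<phi> \<and> \<not> \<phi> ` K \<subseteq> \<real>}"

text \<open>\<open>\<kappa> 1, \<dots>, \<kappa> r\<close> are the real embeddings, with \<open>\<kappa> 1\<close> the identity, and \<open>\<sigma> 1, \<dots>, \<sigma> s\<close>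
  together with their complex conjugates are the remaining ones, without repetition.\<close>

definition embedding_system ::
    "real \<Rightarrow> nat \<Rightarrow> nat \<Rightarrow> (nat \<Rightarrow> real \<Rightarrow> real) \<Rightarrow> (nat \<Rightarrow> real \<Rightarrow> complex) \<Rightarrow> bool" where
  "embedding_system lam r s \<kappa> \<sigma> \<longleftrightarrow>
     bij_betw \<kappa> {1..r} (real_embeddings (rat_adjoin lam)) \<and>
     \<kappa> 1 = restrict id (rat_adjoin lam) \<and>
     bij_betw (\<lambda>(i, conj). if conj then compose (rat_adjoin lam) cnj (\<sigma> i) else \<sigma> i)
       ({1..s} \<times> UNIV) (nonreal_embeddings (rat_adjoin lam))"

text \<open>Internal space is \<open>real^'k\<close>, where each coordinate index carries a label that says which
  component of the star map it holds. The labelling \<open>lab\<close> is a bijection onto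
  \<open>coord_labels r s\<close>, so that \<open>CARD('k) = (r - 1) + 2 * s = d - 1\<close>.\<close>

datatype coord = RealC nat | ReC nat | ImC nat

definition coord_labels :: "nat \<Rightarrow> nat \<Rightarrow> coord set" where
  "coord_labels r s = RealC ` {2..r} \<union> ReC ` {1..s} \<union> ImC ` {1..s}"

definition star_map ::
    "('k::finite \<Rightarrow> coord) \<Rightarrow> (nat \<Rightarrow> real \<Rightarrow> real) \<Rightarrow> (nat \<Rightarrow> real \<Rightarrow> complex) \<Rightarrow> real \<Rightarrow> real^'k"
  where
  "star_map lab \<kappa> \<sigma> x = (\<chi> a. case lab a of
      RealC i \<Rightarrow> \<kappa> i x | ReC i \<Rightarrow> Re (\<sigma> i x) | ImC i \<Rightarrow> Im (\<sigma> i x))"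

definition star_matrix ::
    "('k::finite \<Rightarrow> coord) \<Rightarrow> (nat \<Rightarrow> real \<Rightarrow> real) \<Rightarrow> (nat \<Rightarrow> real \<Rightarrow> complex) \<Rightarrow> real \<Rightarrow> real^'k^'k"
  where
  "star_matrix lab \<kappa> \<sigma> lam = (\<chi> a b. case (lab a, lab b) of
      (RealC i, RealC j) \<Rightarrow> if i = j then \<kappa> i lam else 0
    | (ReC i, ReC j) \<Rightarrow> if i = j then Re (\<sigma> i lam) else 0
    | (ReC i, ImC j) \<Rightarrow> if i = j then - Im (\<sigma> i lam) else 0
    | (ImC i, ReC j) \<Rightarrow> if i = j then Im (\<sigma> i lam) else 0
    | (ImC i, ImC j) \<Rightarrow> if i = j then Re (\<sigma> i lam) else 0
    | _ \<Rightarrow> 0)"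

text \<open>The left endpoints of the tiles in the tiling by intervals of lengths \<open>len\<close> coded by the
  bi-infinite word \<open>w\<close>, relative to that of the tile with index 0.\<close>

definition control_point :: "('n \<Rightarrow> real) \<Rightarrow> (int \<Rightarrow> 'n) \<Rightarrow> int \<Rightarrow> real" where
  "control_point len w n = (if n \<ge> 0 then (\<Sum>m\<in>{0..<n}. len (w m)) else - (\<Sum>m\<in>{n..<0}. len (w m)))"

definition invariant_submodule :: "real \<Rightarrow> real set \<Rightarrow> bool" where
  "invariant_submodule lam S \<longleftrightarrow> S \<subseteq> int_adjoin lam \<and> 0 \<in> S \<and>
     (\<forall>x\<in>S. \<forall>y\<in>S. x - y \<in> S) \<and> (\<forall>x\<in>S. lam * x \<in> S)"

definition control_points_generate :: "real \<Rightarrow> ('n \<Rightarrow> real) \<Rightarrow> (int \<Rightarrow> 'n) \<Rightarrow> bool" where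
  "control_points_generate lam len w \<longleftrightarrow>
     range (control_point len w) \<subseteq> int_adjoin lam \<and>
     (\<forall>S. invariant_submodule lam S \<longrightarrow> range (control_point len w) \<subseteq> S \<longrightarrow> S = int_adjoin lam)"

definition displacements :: "('n \<Rightarrow> 'n list) \<Rightarrow> ('n \<Rightarrow> real) \<Rightarrow> 'n \<Rightarrow> 'n \<Rightarrow> real set" where
  "displacements \<rho> len i j =
     {\<Sum>m<n. len (\<rho> j ! m) | n. n < length (\<rho> j) \<and> \<rho> j ! n = i}"

definition internal_fourier_matrix ::
    "(real \<Rightarrow> real^'k) \<Rightarrow> ('n::finite \<Rightarrow> 'n \<Rightarrow> real set) \<Rightarrow> real^'k \<Rightarrow> complex^'n^'n" where
  "internal_fourier_matrix star T y =
     (\<chi> i j. \<Sum>x\<in>T i j. exp (2 * of_real pi * \<i> * of_real (star x \<bullet> y)))"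

fun internal_cocycle ::
    "(real \<Rightarrow> real^'k) \<Rightarrow> ('n::finite \<Rightarrow> 'n \<Rightarrow> real set) \<Rightarrow> real^'k^'k \<Rightarrow> nat \<Rightarrow> real^'k \<Rightarrow> complex^'n^'n"
  where
  "internal_cocycle star T R 0 y = mat 1"
| "internal_cocycle star T R (Suc n) y =
     internal_cocycle star T R n y ** internal_fourier_matrix star T (((*v) R ^^ n) y)"

definition inverse_fourier :: "(real^'k \<Rightarrow> complex) \<Rightarrow> real^'k \<Rightarrow> complex" where
  "inverse_fourier g y = (LINT x|lborel. exp (2 * of_real pi * \<i> * of_real (x \<bullet> y)) * g x)"

end

theory Submission
  imports Defs
begin

text \<open>
  Since \<open>1/lam\<close> is integral, the norm of \<open>lam\<close> has modulus at most 1, so \<open>lam * \<bar>det Q\<bar> \<le> 1\<close>.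
  Conversely, comparing volumes in \<open>W\<^sub>i = \<Union> (Q W\<^sub>j + t\<^sup>\<star>)\<close> gives \<open>\<eta> v\<^sub>i \<le> \<bar>det Q\<bar> lam \<eta> v\<^sub>i\<close>. Hence
  \<open>\<beta> = 1/lam\<close>, the pieces of \<open>W\<^sub>i\<close> are disjoint up to null sets, and Fourier transformation yields
  \<open>f y = \<beta> B(y) f(R y)\<close>. Put \<open>P\<^sub>n(y) = \<beta>\<^sup>n B\<^sup>(\<^sup>n\<^sup>)(y)\<close>. Iterating, \<open>f y = P\<^sub>n(y) f(R\<^sup>n y)\<close>; as \<open>R\<close> is a
  contraction, \<open>f(R\<^sup>n y)\<close> tends to \<open>f 0 = \<eta> v\<close>, and \<open>P\<^sub>n(y)\<close> is bounded, so \<open>P\<^sub>n(y) v\<close> tends to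
  \<open>c = f y / \<eta>\<close>. Finally \<open>P\<^sub>n\<^sub>+\<^sub>m(y) = P\<^sub>n(y) P\<^sub>m(R\<^sup>n y)\<close>, where for a suitable fixed \<open>m\<close> and large \<open>n\<close> the
  second factor is close to the Perron-Frobenius projection \<open>|v\<rangle>\<langle>u|\<close>; hence \<open>P\<^sub>n(y)\<close> tends to
  \<open>|c\<rangle>\<langle>u|\<close>.
\<close>

section \<open>Perron-Frobenius asymptotics of the cocycle\<close>

text \<open>The new factor is appended on the right, as in \<open>internal_cocycle\<close>, so that
  inductions over the two run in parallel.\<close>

fun matrix_power :: "'a::semiring_1^'n^'n \<Rightarrow> nat \<Rightarrow> 'a^'n^'n" where
  "matrix_power A 0 = mat 1"
| "matrix_power A (Suc n) = matrix_power A n ** A"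

lemma matrix_power_add:
  "matrix_power A (m + n) = matrix_power A m ** matrix_power A n"
  by (induction n) (simp_all add: matrix_mul_assoc)

lemma matrix_power_vector_fixed:
  fixes A :: "'a::comm_semiring_1^'n^'n"
  assumes "A *v v = v"
  shows "matrix_power A n *v v = v"
  by (induction n) (simp_all add: assms flip: matrix_vector_mul_assoc)

lemma matrix_mult_entry: "(A ** B) $ i $ j = (\<Sum>k\<in>UNIV. A $ i $ k * B $ k $ j)"
  by (simp add: matrix_matrix_mult_def)

lemma matrix_add_rdistrib: "(A + B) ** C = A ** C + B ** C"
  by (simp add: vec_eq_iff matrix_mult_entry distrib_right sum.distrib)

lemma matrix_power_scaleR:
  fixes A :: "real^'n^'n"
  shows "matrix_power (b *\<^sub>R A) n = b ^ n *\<^sub>R matrix_power A n"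
  by (induction n) (simp_all add: vec_eq_iff matrix_mult_entry sum_distrib_left mult_ac)

text \<open>With \<open>P = |v\<rangle>\<langle>u|\<close>, a positive power of \<open>A\<close> dominates \<open>\<delta> P\<close>, and the remainder,
  which is non-negative with \<open>v\<close> as eigenvector for \<open>1 - \<delta>\<close>, decays geometrically.\<close>

lemma matrix_power_near_projection:
  fixes A :: "real^'n^'n" and u v :: "real^'n"
  assumes v: "\<And>i. v $ i > 0" and u: "\<And>i. u $ i > 0" and uv: "(\<Sum>i\<in>UNIV. u $ i * v $ i) = 1"
    and Av: "A *v v = v" and uA: "u v* A = u"
    and pos: "\<And>i j. matrix_power A k $ i $ j > 0"
    and e: "\<epsilon> > 0"
  obtains m where "\<And>i j. \<bar>matrix_power A m $ i $ j - v $ i * u $ j\<bar> \<le> \<epsilon> * v $ i"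
proof -
  define B where "B = matrix_power A k"
  define P where "P = (\<chi> i j. v $ i * u $ j)"
  have Bv: "B *v v = v"
    unfolding B_def using Av by (rule matrix_power_vector_fixed)
  have uB: "u v* B = u"
    unfolding B_def by (induction k) (simp_all add: uA flip: vector_matrix_mul_assoc)
  have uB': "(\<Sum>i\<in>UNIV. u $ i * B $ i $ j) = u $ j" for j
    using uB by (simp add: vector_matrix_mult_def vec_eq_iff mult_ac)
  \<comment> \<open>The smallest entrywise ratio keeps \<open>B - \<delta> P\<close> non-negative;
    the cap \<open>1/2\<close> ensures \<delta> < 1.\<close>
  define \<delta> where "\<delta> = min (1/2) (Min ((\<lambda>(i,j). B $ i $ j / P $ i $ j) ` UNIV))"
  have Ppos: "P $ i $ j > 0" for i j using u v by (simp add: P_def)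
  have d0: "\<delta> > 0" using pos Ppos by (auto simp: \<delta>_def B_def)
  have d1: "\<delta> < 1" by (auto simp: \<delta>_def)
  have dB: "\<delta> * P $ i $ j \<le> B $ i $ j" for i j
  proof -
    have "\<delta> \<le> (\<lambda>(i,j). B $ i $ j / P $ i $ j) (i,j)"
      unfolding \<delta>_def by (intro min.coboundedI2 Min_le) auto
    then show ?thesis using Ppos[of i j] by (simp add: field_simps)
  qed
  have PB: "P ** B = P"
    by (simp add: vec_eq_iff P_def matrix_mult_entry mult.assoc uB' flip: sum_distrib_left)
  \<comment> \<open>The remainder constructed is the n-th power of \<open>B - \<delta> P\<close>.
    Only its sign and its action on \<open>v\<close> are recorded, since these already bound its
    entries.\<close>
  have main: "\<exists>E. matrix_power A (n * k) = (1 - (1 - \<delta>) ^ n) *\<^sub>R P + E \<and>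
      (\<forall>i j. E $ i $ j \<ge> 0) \<and> E *v v = (1 - \<delta>) ^ n *\<^sub>R v" for n
  proof (induction n)
    case 0
    show ?case by (intro exI[of _ "mat 1"] conjI) (simp_all, simp add: mat_def)
  next
    case (Suc n)
    then obtain E where E: "matrix_power A (n * k) = (1 - (1 - \<delta>) ^ n) *\<^sub>R P + E"
      "\<And>i j. E $ i $ j \<ge> 0" "E *v v = (1 - \<delta>) ^ n *\<^sub>R v" by blast
    define D where "D = B - \<delta> *\<^sub>R P"
    have Ev: "(\<Sum>l\<in>UNIV. E $ i $ l * v $ l) = (1 - \<delta>) ^ n * v $ i" for i
      using E(3) by (simp add: matrix_vector_mult_def vec_eq_iff)
    have EP: "E ** P = (1 - \<delta>) ^ n *\<^sub>R P"
      by (simp add: vec_eq_iff P_def matrix_mult_entry Ev flip: mult.assoc sum_distrib_right)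
    have Dv: "D *v v = (1 - \<delta>) *\<^sub>R v"
    proof -
      have "P *v v = v" using uv
        by (simp add: vec_eq_iff P_def matrix_vector_mult_def mult.assoc flip: sum_distrib_left)
      then show ?thesis
        by (simp add: D_def matrix_vector_mult_diff_rdistrib Bv scaleR_left_diff_distrib
            flip: scaleR_matrix_vector_assoc)
    qed
    have "matrix_power A (Suc n * k) = ((1 - (1 - \<delta>) ^ n) *\<^sub>R P + E) ** B"
      by (simp only: mult_Suc add.commute[of k] matrix_power_add B_def E(1))
    also have "\<dots> = (1 - (1 - \<delta>) ^ n) *\<^sub>R P + E ** (\<delta> *\<^sub>R P + D)"
      by (simp add: D_def matrix_add_rdistrib PB flip: scalar_matrix_assoc)
    also have "\<dots> = (1 - (1 - \<delta>) ^ Suc n) *\<^sub>R P + E ** D"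
      by (simp add: matrix_add_ldistrib matrix_scalar_ac EP algebra_simps flip: scalar_matrix_assoc)
    finally have 1: "matrix_power A (Suc n * k) = (1 - (1 - \<delta>) ^ Suc n) *\<^sub>R P + E ** D" .
    have 2: "(E ** D) $ i $ j \<ge> 0" for i j
      using E(2) dB by (auto simp: matrix_mult_entry D_def intro!: sum_nonneg mult_nonneg_nonneg)
    have 3: "(E ** D) *v v = (1 - \<delta>) ^ Suc n *\<^sub>R v"
      by (simp add: Dv E(3) matrix_vector_mult_scaleR flip: matrix_vector_mul_assoc)
    show ?case using 1 2 3 by blast
  qed
  \<comment> \<open>In column j, relative to the decaying factor times \<open>v $ i\<close>, the
    remainder contributes at most \<open>1 / v $ j\<close> and the missing part of \<open>P\<close>
    contributes \<open>u $ j\<close>.\<close>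
  define K where "K = Max ((\<lambda>j. 1 / v $ j + u $ j) ` UNIV)"
  have K: "1 / v $ j + u $ j \<le> K" for j unfolding K_def by (intro Max_ge) auto
  have K0: "K > 0" using K[of undefined] u[of undefined] v[of undefined]
    by (smt (verit) divide_pos_pos)
  obtain n where n: "(1 - \<delta>) ^ n < \<epsilon> / K"
    using real_arch_pow_inv[of "\<epsilon> / K" "1 - \<delta>"] e K0 d0 by auto
  obtain E where E: "matrix_power A (n * k) = (1 - (1 - \<delta>) ^ n) *\<^sub>R P + E"
      "\<And>i j. E $ i $ j \<ge> 0" "E *v v = (1 - \<delta>) ^ n *\<^sub>R v" using main by blast
  show ?thesis
  proof
    fix i j
    let ?q = "(1 - \<delta>) ^ n"
    have q: "?q \<ge> 0" using d1 by simp
    \<comment> \<open>By non-negativity one entry is bounded by the whole weighted row sum, which is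
      known because \<open>v\<close> is an eigenvector of \<open>E\<close>.\<close>
    have "E $ i $ j * v $ j \<le> (\<Sum>l\<in>UNIV. E $ i $ l * v $ l)"
      using E(2) v by (intro member_le_sum) (auto simp: less_imp_le)
    also have "\<dots> = ?q * v $ i" using E(3) by (simp add: matrix_vector_mult_def vec_eq_iff)
    finally have Eij: "E $ i $ j \<le> ?q * v $ i * (1 / v $ j)"
      using v[of j] by (simp add: field_simps)
    have "\<bar>matrix_power A (n * k) $ i $ j - v $ i * u $ j\<bar> = \<bar>E $ i $ j - ?q * v $ i * u $ j\<bar>"
      unfolding E(1) by (simp add: P_def algebra_simps)
    also have "\<dots> \<le> E $ i $ j + ?q * v $ i * u $ j"
      using E(2)[of i j] q u[of j] v[of i] by (smt (verit) mult_nonneg_nonneg)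
    also have "\<dots> \<le> ?q * v $ i * (1 / v $ j + u $ j)"
      using Eij by (simp add: algebra_simps)
    also have "\<dots> \<le> (\<epsilon> / K) * v $ i * K"
      using n K q v[of i] u[of j] v[of j] e K0
      by (intro mult_mono) (auto intro!: add_nonneg_nonneg mult_nonneg_nonneg simp: less_imp_le)
    also have "\<dots> = \<epsilon> * v $ i" using K0 by simp
    finally show "\<bar>matrix_power A (n * k) $ i $ j - v $ i * u $ j\<bar> \<le> \<epsilon> * v $ i" .
  qed
qed

section \<open>Bounds and limits of the internal cocycle\<close>

lemma norm_internal_fourier_matrix_le:
  "norm (internal_fourier_matrix star T y $ i $ j) \<le> card (T i j)"
proof -
  have "norm (internal_fourier_matrix star T y $ i $ j) =
      norm (\<Sum>x\<in>T i j. exp (2 * of_real pi * \<i> * of_real (star x \<bullet> y)))"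
    by (simp add: internal_fourier_matrix_def)
  also have "\<dots> \<le> (\<Sum>x\<in>T i j. norm (exp (2 * of_real pi * \<i> * of_real (star x \<bullet> y))))"
    by (rule norm_sum)
  also have "\<dots> = card (T i j)" by (simp add: norm_exp_eq_Re)
  finally show ?thesis .
qed

lemma internal_fourier_matrix_0: "internal_fourier_matrix star T 0 $ i $ j = of_nat (card (T i j))"
  by (simp add: internal_fourier_matrix_def)

lemma isCont_internal_fourier_matrix:
  "isCont (\<lambda>y. internal_fourier_matrix star T y $ i $ j) y"
  unfolding internal_fourier_matrix_def by (auto intro!: continuous_intros)

lemma internal_cocycle_add:
  "internal_cocycle star T R (n + m) y =
     internal_cocycle star T R n y ** internal_cocycle star T R m (((*v) R ^^ n) y)"
proof (induction m)
  case (Suc m)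
  have "((*v) R ^^ (n + m)) y = ((*v) R ^^ m) (((*v) R ^^ n) y)"
    by (simp add: funpow_add add.commute)
  with Suc show ?case by (simp add: matrix_mul_assoc)
qed simp

text \<open>Each Fourier matrix is dominated entrywise by the matrix of cardinalities, which fixes
  \<open>v\<close> after scaling by \<beta>. Hence the row sums weighted by \<open>v\<close> never
  grow. This is the bound on the scaled cocycle that is uniform in n and y.\<close>

lemma internal_cocycle_row_sum_le:
  fixes v :: "real^'n"
  assumes \<beta>: "\<beta> \<ge> 0" and v: "\<And>i. v $ i > 0"
    and Mv: "\<And>i. \<beta> * (\<Sum>j\<in>UNIV. real (card (T i j)) * v $ j) = v $ i"
  shows "(\<Sum>j\<in>UNIV. norm ((\<beta> ^ n *\<^sub>R internal_cocycle star T R n y) $ i $ j) * v $ j) \<le> v $ i"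
proof (induction n)
  case 0
  have "(\<Sum>j\<in>UNIV. norm ((\<beta> ^ 0 *\<^sub>R internal_cocycle star T R 0 y) $ i $ j) * v $ j)
     = (\<Sum>j\<in>UNIV. if j = i then v $ j else 0)"
    by (intro sum.cong) (auto simp: mat_def)
  then show ?case by simp
next
  case (Suc n)
  let ?P = "\<lambda>n. \<beta> ^ n *\<^sub>R internal_cocycle star T R n y"
  let ?B = "internal_fourier_matrix star T (((*v) R ^^ n) y)"
  have "norm (?P (Suc n) $ i $ j) \<le> (\<Sum>l\<in>UNIV. norm (?P n $ i $ l) * (\<beta> * real (card (T l j))))" for j
  proof -
    have "?P (Suc n) $ i $ j = (\<Sum>l\<in>UNIV. ?P n $ i $ l * (\<beta> *\<^sub>R ?B $ l $ j))"
      by (simp add: matrix_mult_entry scaleR_sum_right mult_ac)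
    also have "norm \<dots> \<le> (\<Sum>l\<in>UNIV. norm (?P n $ i $ l) * (\<beta> * norm (?B $ l $ j)))"
      using \<beta> by (intro order_trans[OF norm_sum]) (simp add: norm_mult mult_ac)
    also have "\<dots> \<le> (\<Sum>l\<in>UNIV. norm (?P n $ i $ l) * (\<beta> * real (card (T l j))))"
      using \<beta> by (intro sum_mono mult_left_mono norm_internal_fourier_matrix_le) auto
    finally show ?thesis .
  qed
  then have "(\<Sum>j\<in>UNIV. norm (?P (Suc n) $ i $ j) * v $ j) \<le>
      (\<Sum>j\<in>UNIV. (\<Sum>l\<in>UNIV. norm (?P n $ i $ l) * (\<beta> * real (card (T l j)))) * v $ j)"
    using v by (intro sum_mono mult_right_mono) (auto simp: less_imp_le)
  also have "\<dots> = (\<Sum>l\<in>UNIV. norm (?P n $ i $ l) * (\<beta> * (\<Sum>j\<in>UNIV. real (card (T l j)) * v $ j)))"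
    unfolding sum_distrib_right sum_distrib_left by (subst sum.swap) (simp add: mult_ac)
  also have "\<dots> \<le> v $ i" using Suc by (simp add: Mv)
  finally show ?case .
qed

text \<open>The cocycle is split after n steps into a bounded left factor and a block of fixed
  length m. First m is chosen so that the m-th power of the scaled matrix is close to the
  projection, then n so large that the block is close to this power. Convergence on the single
  vector \<open>v\<close> then determines the limit of the whole matrix.\<close>

lemma internal_cocycle_tendsto_rank_one:
  fixes T :: "'n::finite \<Rightarrow> 'n \<Rightarrow> real set" and u v :: "real^'n" and R :: "real^'k^'k"
    and star :: "real \<Rightarrow> real^'k" and \<beta> :: real
    and c :: "complex^'n"
  defines "M \<equiv> \<chi> i j. real (card (T i j))"
  defines "P \<equiv> \<lambda>n y. \<beta> ^ n *\<^sub>R internal_cocycle star T R n y"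
  assumes \<beta>: "\<beta> > 0" and v: "\<And>i. v $ i > 0" and u: "\<And>i. u $ i > 0"
    and uv: "(\<Sum>i\<in>UNIV. u $ i * v $ i) = 1"
    and Mv: "\<beta> *\<^sub>R (M *v v) = v" and uM: "\<beta> *\<^sub>R (u v* M) = u"
    and pos: "\<And>i j. matrix_power M k $ i $ j > 0"
    and R: "(\<lambda>n. ((*v) R ^^ n) y) \<longlonglongrightarrow> 0"
    and c: "(\<lambda>n. P n y *v complexify_vec v) \<longlonglongrightarrow> c"
  shows "(\<lambda>n. P n y) \<longlonglongrightarrow> (\<chi> i j. c $ i * complex_of_real (u $ j))"
proof -
  have Mv': "\<beta> * (\<Sum>j\<in>UNIV. real (card (T i j)) * v $ j) = v $ i" for i
    using Mv by (simp add: M_def vec_eq_iff matrix_vector_mult_def)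
  have row: "(\<Sum>j\<in>UNIV. norm (P n y $ i $ j) * v $ j) \<le> v $ i" for n i
    unfolding P_def by (intro internal_cocycle_row_sum_le v Mv' less_imp_le[OF \<beta>])
  \<comment> \<open>For fixed m there are only m factors, and each tends to its value at 0, the
    scaled cardinality matrix, because the orbit tends to 0.\<close>
  have Pm: "(\<lambda>n. P m (((*v) R ^^ n) y) $ i $ j) \<longlonglongrightarrow>
      complex_of_real (matrix_power (\<beta> *\<^sub>R M) m $ i $ j)" for m i j
  proof (induction m arbitrary: i j)
    case 0
    then show ?case by (simp add: P_def mat_def)
  next
    case (Suc m)
    have "((*v) R ^^ (n + m)) y = ((*v) R ^^ m) (((*v) R ^^ n) y)" for n
      by (metis add.commute comp_apply funpow_add)
    with LIMSEQ_ignore_initial_segment[OF R, of m]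
    have Rm: "(\<lambda>n. ((*v) R ^^ m) (((*v) R ^^ n) y)) \<longlonglongrightarrow> 0" by simp
    have B: "(\<lambda>n. internal_fourier_matrix star T (((*v) R ^^ m) (((*v) R ^^ n) y)) $ l $ j)
        \<longlonglongrightarrow> complex_of_real (M $ l $ j)" for l
      using isCont_tendsto_compose[OF isCont_internal_fourier_matrix Rm, of star T l j]
      by (simp add: internal_fourier_matrix_0 M_def)
    have "(\<lambda>n. \<Sum>l\<in>UNIV. P m (((*v) R ^^ n) y) $ i $ l *
        (\<beta> *\<^sub>R internal_fourier_matrix star T (((*v) R ^^ m) (((*v) R ^^ n) y)) $ l $ j))
      \<longlonglongrightarrow> (\<Sum>l\<in>UNIV. complex_of_real (matrix_power (\<beta> *\<^sub>R M) m $ i $ l) * (\<beta> *\<^sub>R complex_of_real (M $ l $ j)))"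
      by (intro tendsto_intros Suc B)
    then show ?case
      by (simp add: P_def matrix_mult_entry scaleR_sum_right sum_distrib_left mult_ac
          scaleR_conv_of_real[where 'a = complex])
  qed
  have "(\<lambda>n. P n y $ i $ j) \<longlonglongrightarrow> c $ i * complex_of_real (u $ j)" for i j
  proof (rule LIMSEQ_I)
    fix r :: real assume r: "r > 0"
    \<comment> \<open>Two approximations with error \<epsilon> relative to \<open>v $ l\<close>,
      summed against the weighted row bound, cost
      \<open>2 * \<epsilon> * v $ i = r / 2\<close>.\<close>
    define \<epsilon> where "\<epsilon> = r / (4 * v $ i)"
    have \<epsilon>: "\<epsilon> > 0" using r v by (simp add: \<epsilon>_def)
    have "(\<beta> *\<^sub>R M) *v v = v" "u v* (\<beta> *\<^sub>R M) = u"
      using Mv uM by (simp_all add: scaleR_matrix_vector_assoc vector_scaleR_matrix_ac)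
    moreover have "matrix_power (\<beta> *\<^sub>R M) k $ i $ j > 0" for i j
      using pos \<beta> by (simp add: matrix_power_scaleR)
    ultimately obtain m where
      m: "\<And>i j. \<bar>matrix_power (\<beta> *\<^sub>R M) m $ i $ j - v $ i * u $ j\<bar> \<le> \<epsilon> * v $ i"
      using matrix_power_near_projection[OF v u uv _ _ _ \<epsilon>] by metis
    have 1: "\<forall>\<^sub>F n in sequentially. \<forall>l. dist (P m (((*v) R ^^ n) y) $ l $ j)
        (complex_of_real (matrix_power (\<beta> *\<^sub>R M) m $ l $ j)) < \<epsilon> * v $ l"
      using tendstoD[OF Pm] \<epsilon> v by (intro eventually_all_finite) auto
    have "(\<lambda>n. (P n y *v complexify_vec v) $ i * complex_of_real (u $ j)) \<longlonglongrightarrow> c $ i * complex_of_real (u $ j)"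
      by (intro tendsto_intros c)
    then have 2: "\<forall>\<^sub>F n in sequentially. dist ((P n y *v complexify_vec v) $ i * complex_of_real (u $ j))
        (c $ i * complex_of_real (u $ j)) < r / 2"
      using r by (intro tendstoD) auto
    have "\<forall>\<^sub>F n in sequentially. norm (P (n + m) y $ i $ j - c $ i * complex_of_real (u $ j)) < r"
      using 1 2
    proof eventually_elim
      case (elim n)
      let ?Q = "P m (((*v) R ^^ n) y)"
      have eq: "P (n + m) y = P n y ** ?Q"
        by (simp add: P_def internal_cocycle_add power_add vec_eq_iff matrix_mult_entry
            scaleR_sum_right mult_ac)
      have "norm (?Q $ l $ j - complex_of_real (v $ l * u $ j)) \<le> 2 * \<epsilon> * v $ l" for l
      proof -
        have "norm (complex_of_real (matrix_power (\<beta> *\<^sub>R M) m $ l $ j - v $ l * u $ j)) \<le> \<epsilon> * v $ l"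
          using m[of l j] by (simp only: norm_of_real)
        moreover have "norm (?Q $ l $ j - complex_of_real (matrix_power (\<beta> *\<^sub>R M) m $ l $ j)) < \<epsilon> * v $ l"
          using elim(1) by (simp add: dist_norm)
        ultimately show ?thesis
          using norm_triangle_ineq[of "?Q $ l $ j - complex_of_real (matrix_power (\<beta> *\<^sub>R M) m $ l $ j)"
             "complex_of_real (matrix_power (\<beta> *\<^sub>R M) m $ l $ j - v $ l * u $ j)"]
          by simp
      qed
      then have "norm (\<Sum>l\<in>UNIV. P n y $ i $ l * (?Q $ l $ j - complex_of_real (v $ l * u $ j)))
         \<le> (\<Sum>l\<in>UNIV. norm (P n y $ i $ l) * (2 * \<epsilon> * v $ l))"
        by (intro sum_norm_le) (simp add: norm_mult mult_left_mono)
      also have "\<dots> = 2 * \<epsilon> * (\<Sum>l\<in>UNIV. norm (P n y $ i $ l) * v $ l)"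
        by (simp add: sum_distrib_left mult_ac)
      also have "\<dots> \<le> 2 * \<epsilon> * v $ i" using row[of n i] \<epsilon> by (intro mult_left_mono) auto
      also have "\<dots> = r / 2" using v[of i] by (simp add: \<epsilon>_def)
      finally have A: "norm (\<Sum>l\<in>UNIV. P n y $ i $ l * (?Q $ l $ j - complex_of_real (v $ l * u $ j))) \<le> r / 2" .
      \<comment> \<open>Splitting the outer product off from \<open>?Q\<close> leaves the small
        error just estimated and \<open>P n y\<close> applied to \<open>v\<close>, times
        \<open>u $ j\<close>, whose limit is given.\<close>
      have "P (n + m) y $ i $ j = (\<Sum>l\<in>UNIV. P n y $ i $ l * (?Q $ l $ j - complex_of_real (v $ l * u $ j)))
          + (P n y *v complexify_vec v) $ i * complex_of_real (u $ j)"
        by (simp add: eq matrix_mult_entry matrix_vector_mult_def complexify_vec_def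
            sum_distrib_left right_diff_distrib sum_subtractf mult_ac)
      then show ?case using A elim(2)
        norm_triangle_ineq[of "\<Sum>l\<in>UNIV. P n y $ i $ l * (?Q $ l $ j - complex_of_real (v $ l * u $ j))"
          "(P n y *v complexify_vec v) $ i * complex_of_real (u $ j) - c $ i * complex_of_real (u $ j)"]
        by (simp add: dist_norm algebra_simps)
    qed
    then have "\<forall>\<^sub>F n in sequentially. norm (P n y $ i $ j - c $ i * complex_of_real (u $ j)) < r"
      by (rule eventually_sequentially_seg[THEN iffD1])
    then show "\<exists>no. \<forall>n\<ge>no. norm (P n y $ i $ j - c $ i * complex_of_real (u $ j)) < r"
      by (simp add: eventually_sequentially)
  qed
  then show ?thesis by (intro vec_tendstoI) simp
qed

lemma rank_outer_product_le_1:
  fixes c :: "'a::field^'n" and u :: "'a^'m"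
  shows "rank (\<chi> i j. c $ i * u $ j) \<le> 1"
proof -
  have "rows (\<chi> i j. c $ i * u $ j) \<subseteq> vec.span {u}"
    by (auto simp: rows_def row_def vec.span_singleton vector_scalar_mult_def)
  then show ?thesis
    unfolding row_rank_def_gen using vec.dim_le_card[of "rows (\<chi> i j. c $ i * u $ j)" "{u}"] by simp
qed

section \<open>Letter counts and the substitution matrix\<close>

lemma count_list_subst_word:
  "real (count_list (subst_word \<rho> w) i) = (\<Sum>j\<in>UNIV. subst_matrix \<rho> $ i $ j * real (count_list w j))"
proof (induction w)
  case Nil
  then show ?case by (simp add: subst_word_def)
next
  case (Cons a w)
  have "(\<Sum>j\<in>UNIV. subst_matrix \<rho> $ i $ j * real (count_list (a # w) j)) =
     (\<Sum>j\<in>UNIV. subst_matrix \<rho> $ i $ j * real (count_list w j) + (if j = a then subst_matrix \<rho> $ i $ j else 0))"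
    by (intro sum.cong) (auto simp: algebra_simps)
  with Cons show ?case
    by (simp add: subst_word_def sum.distrib subst_matrix_def count_list_append)
qed

text \<open>Translates primitivity, a statement about iterated words, into positivity of a power of
  the substitution matrix.\<close>

lemma matrix_power_subst_matrix:
  "matrix_power (subst_matrix \<rho>) k $ i $ j = real (count_list ((subst_word \<rho> ^^ k) [j]) i)"
proof -
  \<comment> \<open>The claim is generalised from single letters to words, because the induction
    passes from \<open>w\<close> to its image.\<close>
  have "real (count_list ((subst_word \<rho> ^^ k) w) i) =
      (\<Sum>j\<in>UNIV. matrix_power (subst_matrix \<rho>) k $ i $ j * real (count_list w j))" for w
  proof (induction k arbitrary: w)
    case 0
    have "(\<Sum>j\<in>UNIV. (mat 1 :: real^'a^'a) $ i $ j * real (count_list w j)) =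
       (\<Sum>j\<in>UNIV. if j = i then real (count_list w j) else 0)"
      by (intro sum.cong) (auto simp: mat_def)
    then show ?case by simp
  next
    case (Suc k)
    have "real (count_list ((subst_word \<rho> ^^ Suc k) w) i) =
       (\<Sum>l\<in>UNIV. matrix_power (subst_matrix \<rho>) k $ i $ l *
         (\<Sum>j\<in>UNIV. subst_matrix \<rho> $ l $ j * real (count_list w j)))"
      by (simp add: funpow_Suc_right Suc count_list_subst_word del: funpow.simps)
    also have "\<dots> = (\<Sum>j\<in>UNIV. matrix_power (subst_matrix \<rho>) (Suc k) $ i $ j * real (count_list w j))"
      unfolding sum_distrib_left matrix_power.simps matrix_mult_entry sum_distrib_right
      by (subst sum.swap) (simp add: mult_ac)
    finally show ?case .
  qed
  from this[of "[j]"] show ?thesis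
    by (simp add: if_distrib[of "\<lambda>x. _ * x"] if_distrib[of real] cong: if_cong)
qed

text \<open>Positive lengths make the partial sums strictly increasing, so different occurrences of
  a letter have different positions and no multiplicity is lost in the set.\<close>

lemma card_displacements:
  assumes "\<And>a. len a > 0"
  shows "card (displacements \<rho> len i j) = count_list (\<rho> j) i"
proof -
  let ?I = "{n. n < length (\<rho> j) \<and> \<rho> j ! n = i}" and ?s = "\<lambda>n. \<Sum>m<n. len (\<rho> j ! m)"
  have "strict_mono ?s" using assms by (intro strict_monoI_Suc) simp
  then have "inj_on ?s ?I" using strict_mono_imp_inj_on inj_on_subset by blast
  moreover have "displacements \<rho> len i j = ?s ` ?I" by (auto simp: displacements_def)
  ultimately have "card (displacements \<rho> len i j) = card ?I" by (simp add: card_image)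
  also have "\<dots> = count_list (\<rho> j) i"
    by (simp add: count_list_eq_length_filter length_filter_conv_card eq_commute)
  finally show ?thesis .
qed

lemma finite_displacements: "finite (displacements \<rho> len i j)"
  by (simp add: displacements_def)

section \<open>Volumes and Fourier transforms of affine images\<close>

text \<open>For \<open>B\<close> the unit ball, Tonelli's theorem and translation invariance turn
  \<open>\<integral>\<integral> 1\<^sub>A (f x) 1\<^sub>B y\<close> into \<open>\<integral> 1\<^sub>A y (\<integral> 1\<^sub>B (y - f x) dx) dy\<close>, and the inner integral is the
  volume of \<open>B\<close>, because \<open>f\<close> preserves \<open>B\<close>.\<close>

lemma lborel_distr_orthogonal_transformation:
  fixes f :: "'a::euclidean_space \<Rightarrow> 'a"
  assumes f: "orthogonal_transformation f"
  shows "distr lborel borel f = lborel"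
proof (rule measure_eqI)
  fix A :: "'a set" assume "A \<in> sets (distr lborel borel f)"
  then have A [measurable]: "A \<in> sets borel" by simp
  have lin: "linear f" using f by (rule orthogonal_transformation_linear)
  then have [measurable]: "f \<in> borel_measurable borel"
    by (intro borel_measurable_continuous_onI linear_continuous_on linear_conv_bounded_linear[THEN iffD1] lin)
  define B where "B = (ball 0 1 :: 'a set)"
  have [measurable]: "B \<in> sets borel" by (simp add: B_def)
  have shift: "(\<integral>\<^sup>+x. g (x + a) \<partial>lborel) = (\<integral>\<^sup>+x. g x \<partial>lborel)"
    if [measurable]: "g \<in> borel_measurable borel" for a :: 'a and g
    by (subst lborel_distr_plus[of a, symmetric], subst nn_integral_distr) (auto simp: add.commute)
  have ball: "(\<integral>\<^sup>+x. indicator B (y - f x) \<partial>lborel) = emeasure lborel B" for y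
  proof -
    obtain z where z: "y = f z" using orthogonal_transformation_surj[OF f] by (metis surjD)
    have "norm (f z - f x) = norm (x + - z)" for x
      by (metis f lin linear_diff norm_minus_commute orthogonal_transformation_norm uminus_add_conv_diff add.commute)
    then have "(\<integral>\<^sup>+x. indicator B (y - f x) \<partial>lborel) = (\<integral>\<^sup>+x. indicator B (x + - z) \<partial>lborel)"
      by (intro nn_integral_cong) (simp add: z B_def indicator_def)
    then show ?thesis by (subst (asm) shift) auto
  qed
  have "emeasure (distr lborel borel f) A * emeasure lborel B =
      (\<integral>\<^sup>+y. (\<integral>\<^sup>+x. indicator A (f x) * indicator B y \<partial>lborel) \<partial>lborel)"
  proof -
    have "emeasure (distr lborel borel f) A = (\<integral>\<^sup>+x. indicator A x \<partial>distr lborel borel f)"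
      by simp
    also have "\<dots> = (\<integral>\<^sup>+x. indicator A (f x) \<partial>lborel)"
      by (subst nn_integral_distr) auto
    finally show ?thesis by (simp add: nn_integral_multc nn_integral_cmult)
  qed
  \<comment> \<open>For fixed y, translating x by a preimage of y under \<open>f\<close> puts y into
    the argument of the first indicator.\<close>
  also have "\<dots> = (\<integral>\<^sup>+y. (\<integral>\<^sup>+x. indicator A (f x + y) * indicator B y \<partial>lborel) \<partial>lborel)"
  proof (rule nn_integral_cong)
    fix y
    obtain z where z: "y = f z" using orthogonal_transformation_surj[OF f] by (metis surjD)
    have "(\<integral>\<^sup>+x. indicator A (f x) * indicator B y \<partial>lborel) =
        (\<integral>\<^sup>+x. indicator A (f (x + z)) * indicator B y \<partial>lborel)"
      by (rule shift[symmetric]) simp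
    then show "(\<integral>\<^sup>+x. indicator A (f x) * indicator B y \<partial>lborel) =
        (\<integral>\<^sup>+x. indicator A (f x + y) * indicator B y \<partial>lborel)"
      by (simp add: z linear_add[OF lin])
  qed
  also have "\<dots> = (\<integral>\<^sup>+x. (\<integral>\<^sup>+y. indicator A (f x + y) * indicator B y \<partial>lborel) \<partial>lborel)"
    by (rule lborel_pair.Fubini') measurable
  also have "\<dots> = (\<integral>\<^sup>+x. (\<integral>\<^sup>+y. indicator A y * indicator B (y - f x) \<partial>lborel) \<partial>lborel)"
  proof (rule nn_integral_cong)
    fix x
    show "(\<integral>\<^sup>+y. indicator A (f x + y) * indicator B y \<partial>lborel) =
        (\<integral>\<^sup>+y. indicator A y * indicator B (y - f x) \<partial>lborel)"
      using shift[of "\<lambda>y. indicator A y * indicator B (y - f x)" "f x"] by (simp add: add.commute)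
  qed
  also have "\<dots> = (\<integral>\<^sup>+y. (\<integral>\<^sup>+x. indicator A y * indicator B (y - f x) \<partial>lborel) \<partial>lborel)"
    by (rule lborel_pair.Fubini'[symmetric]) measurable
  also have "\<dots> = emeasure lborel A * emeasure lborel B"
    by (simp add: nn_integral_cmult ball nn_integral_multc)
  finally have eq: "emeasure (distr lborel borel f) A * emeasure lborel B = emeasure lborel A * emeasure lborel B" .
  \<comment> \<open>The volume of the ball is positive and finite, so it can be cancelled.\<close>
  have "emeasure lborel B \<noteq> 0" "emeasure lborel B \<noteq> \<infinity>"
    by (auto simp: B_def emeasure_ball ennreal_eq_0_iff less_le_not_le[symmetric] not_le)
  with eq show "emeasure (distr lborel borel f) A = emeasure lborel A"
    by (metis ennreal_mult_divide_eq infinity_ennreal_def)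
qed simp

section \<open>Affine maps whose linear part has orthogonal rows\<close>

lemma matrix_mult_transpose_entry:
  fixes Q :: "real^'m^'n"
  shows "(Q ** transpose Q) $ a $ b = (\<Sum>c\<in>UNIV. Q $ a $ c * Q $ b $ c)"
  by (simp add: matrix_matrix_mult_def transpose_def)

text \<open>The square of the determinant is that of the diagonal matrix
  \<open>Q ** transpose Q\<close>, so the block structure of the star matrix never has to be
  expanded.\<close>

lemma abs_det_orthogonal_rows:
  fixes Q :: "real^'k^'k"
  assumes Q: "Q ** transpose Q = (\<chi> a b. if a = b then (r a)\<^sup>2 else 0)" and r: "\<And>a. r a > 0"
  shows "\<bar>det Q\<bar> = (\<Prod>a\<in>UNIV. r a)"
proof -
  have "(det Q)\<^sup>2 = det (Q ** transpose Q)" by (simp add: det_mul power2_eq_square)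
  also have "\<dots> = (\<Prod>a\<in>UNIV. r a)\<^sup>2"
    unfolding Q by (subst det_diagonal) (auto simp: prod_power_distrib)
  finally show ?thesis
    using r by (simp add: power2_eq_iff prod_nonneg less_imp_le) (smt (verit) prod_pos)
qed

text \<open>Dividing each row by its length gives an orthogonal matrix \<open>U\<close>. The affine
  map is \<open>U\<close>, which preserves Lebesgue measure, followed by a coordinatewise scaling
  and a translation, whose effect on the measure is the product of the row lengths.\<close>

lemma lborel_orthogonal_rows:
  fixes Q :: "real^'k^'k"
  assumes Q: "Q ** transpose Q = (\<chi> a b. if a = b then (r a)\<^sup>2 else 0)" and r: "\<And>a. r a > 0"
  shows "lborel = density (distr lborel borel (\<lambda>x. Q *v x + t)) (\<lambda>_. ennreal \<bar>det Q\<bar>)"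
proof -
  have QQ: "(\<Sum>c\<in>UNIV. Q $ a $ c * Q $ b $ c) = (if a = b then (r a)\<^sup>2 else 0)" for a b
    using Q by (simp add: vec_eq_iff flip: matrix_mult_transpose_entry)
  define U :: "real^'k^'k" where "U = (\<chi> a b. Q $ a $ b / r a)"
  have "U ** transpose U = mat 1"
    using r by (auto simp: vec_eq_iff matrix_mult_transpose_entry U_def QQ mat_def power2_eq_square
        simp flip: sum_divide_distrib) (simp add: less_imp_neq[symmetric])+
  then have "orthogonal_matrix U"
    by (simp add: orthogonal_matrix_def matrix_left_right_inverse)
  then have U: "orthogonal_transformation ((*v) U)"
    by (simp add: orthogonal_transformation_matrix)
  have [measurable]: "(*v) U \<in> borel_measurable borel"
    by (intro borel_measurable_continuous_onI linear_continuous_on linear_conv_bounded_linear[THEN iffD1]) simp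
  \<comment> \<open>Scaling factors are wanted for basis vectors instead of indices; this functional
    takes the value \<open>r a\<close> at \<open>axis a 1\<close>.\<close>
  define c :: "real^'k \<Rightarrow> real" where "c x = (\<Sum>a\<in>UNIV. r a * x $ a)" for x
  define D where "D x = t + (\<Sum>j\<in>Basis. (c j * (x \<bullet> j)) *\<^sub>R j)" for x :: "real^'k"
  have [measurable]: "D \<in> borel_measurable borel" by (simp add: D_def[abs_def])
  have c: "c (axis a 1) = r a" for a
    by (simp add: c_def axis_def if_distrib[of "\<lambda>x. _ * x"] cong: if_cong)
  have B: "(Basis :: (real^'k) set) = range (\<lambda>a. axis a 1)" "inj (\<lambda>a. axis a (1::real) :: real^'k)"
    by (auto simp: Basis_vec_def inj_def axis_eq_axis)
  have DU: "D (U *v x) = Q *v x + t" for x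
  proof -
    have "r a * (U *v x) $ a = (Q *v x) $ a" for a
      using r[of a] by (simp add: U_def matrix_vector_mult_def sum_distrib_left)
    then have "(\<Sum>a\<in>UNIV. (r a * (U *v x) $ a) *\<^sub>R axis a 1) = Q *v x"
      by (simp add: vec_eq_iff axis_def if_distrib[of "\<lambda>x. _ * x"] cong: if_cong)
    then show ?thesis
      by (simp add: D_def B(1) sum.reindex[OF B(2)] c inner_axis)
  qed
  have "(\<Prod>j\<in>Basis. \<bar>c j\<bar>) = \<bar>det Q\<bar>"
    using r by (simp add: abs_det_orthogonal_rows[OF Q r] B(1) prod.reindex[OF B(2)] c less_imp_le)
  moreover have "c j \<noteq> 0" if "j \<in> Basis" for j
    using that r unfolding B(1) by (auto simp: c less_imp_neq[symmetric])
  ultimately have lb: "lborel = density (distr lborel borel D) (\<lambda>_. ennreal \<bar>det Q\<bar>)"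
    using lborel_affine_euclidean[of c t] unfolding D_def[abs_def] by simp
  have "distr lborel borel D = distr (distr lborel borel ((*v) U)) borel D"
    by (simp add: lborel_distr_orthogonal_transformation[OF U])
  also have "\<dots> = distr lborel borel (\<lambda>x. Q *v x + t)"
    by (subst distr_distr) (auto simp: o_def DU)
  finally show ?thesis using lb by (rule subst)
qed

text \<open>Change of variables. The inner product of \<open>Q *v x + t\<close> with
  \<open>y\<close> splits into that of \<open>t\<close> with \<open>y\<close> and that of
  \<open>x\<close> with \<open>transpose Q *v y\<close>, which is why the cocycle runs along the
  transpose.\<close>

lemma inverse_fourier_affine_image:
  fixes Q :: "real^'k^'k"
  assumes Q: "Q ** transpose Q = (\<chi> a b. if a = b then (r a)\<^sup>2 else 0)" and r: "\<And>a. r a > 0"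
    and K: "K \<in> sets borel" and QK: "(\<lambda>x. Q *v x + t) ` K \<in> sets borel"
  shows "inverse_fourier (indicator ((\<lambda>x. Q *v x + t) ` K)) y =
    \<bar>det Q\<bar> *\<^sub>R (exp (2 * of_real pi * \<i> * of_real (t \<bullet> y)) * inverse_fourier (indicator K) (transpose Q *v y))"
proof -
  let ?g = "\<lambda>x. Q *v x + t"
  let ?e = "\<lambda>x y. exp (2 * of_real pi * \<i> * of_real (x \<bullet> y)) :: complex"
  have d: "\<bar>det Q\<bar> > 0" using abs_det_orthogonal_rows[OF Q r] r by (simp add: prod_pos)
  then have inj: "inj ?g"
    by (auto simp: inj_def) (metis inj_def inj_matrix_vector_mult invertible_det_nz abs_0 less_irrefl)
  have [measurable]: "?g \<in> borel_measurable borel"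
    by (intro borel_measurable_continuous_onI continuous_intros linear_continuous_on linear_conv_bounded_linear[THEN iffD1]) simp
  note [measurable] = K QK
  have ind: "indicator (?g ` K) (?g x) = (indicator K x :: complex)" for x
    using inj_image_mem_iff[OF inj, of x K] by (simp only: indicator_def)
  have "inverse_fourier (indicator (?g ` K)) y =
      integral\<^sup>L (density (distr lborel borel ?g) (\<lambda>_. ennreal \<bar>det Q\<bar>)) (\<lambda>x. ?e x y * indicator (?g ` K) x)"
    unfolding inverse_fourier_def by (subst lborel_orthogonal_rows[OF Q r, of t]) simp
  also have "\<dots> = (LINT x|lborel. \<bar>det Q\<bar> *\<^sub>R (?e (?g x) y * indicator (?g ` K) (?g x)))"
    by (subst integral_density) (auto simp: integral_distr)
  also have "\<dots> = (LINT x|lborel. (\<bar>det Q\<bar> *\<^sub>R ?e t y) * (?e x (transpose Q *v y) * indicator K x))"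
  proof (rule Bochner_Integration.integral_cong)
    fix x
    have "?g x \<bullet> y = t \<bullet> y + x \<bullet> (transpose Q *v y)"
      using dot_lmul_matrix[of y Q x] by (simp add: inner_add_left inner_add_right inner_commute)
    then show "\<bar>det Q\<bar> *\<^sub>R (?e (?g x) y * indicator (?g ` K) (?g x)) =
        (\<bar>det Q\<bar> *\<^sub>R ?e t y) * (?e x (transpose Q *v y) * indicator K x)"
      by (simp add: ind exp_add distrib_left)
  qed simp
  finally show ?thesis by (simp add: inverse_fourier_def)
qed

text \<open>At 0 the inverse Fourier transform of an indicator is the volume, so the preceding
  transformation rule specialises to this one.\<close>

lemma measure_affine_image:
  fixes Q :: "real^'k^'k"
  assumes Q: "Q ** transpose Q = (\<chi> a b. if a = b then (r a)\<^sup>2 else 0)" and r: "\<And>a. r a > 0"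
    and K: "compact K"
  shows "measure lborel ((\<lambda>x. Q *v x + t) ` K) = \<bar>det Q\<bar> * measure lborel K"
proof -
  have *: "inverse_fourier (indicator S) 0 = complex_of_real (measure lborel S)"
    if "compact S" for S :: "(real^'k) set"
  proof -
    have "inverse_fourier (indicator S) 0 = (LINT x|lborel. complex_of_real (indicat_real S x))"
      by (simp add: inverse_fourier_def of_real_indicator)
    also have "\<dots> = complex_of_real (measure lborel S)" 
      by (subst integral_complex_of_real) simp
    finally show ?thesis .
  qed
  have QK: "compact ((\<lambda>x. Q *v x + t) ` K)"
    by (intro compact_continuous_image K continuous_intros linear_continuous_on linear_conv_bounded_linear[THEN iffD1]) simp
  have "complex_of_real (measure lborel ((\<lambda>x. Q *v x + t) ` K)) = complex_of_real (\<bar>det Q\<bar> * measure lborel K)"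
    using inverse_fourier_affine_image[OF Q r borel_compact[OF K] borel_compact[OF QK], of 0]
    by (simp add: * K QK scaleR_conv_of_real)
  then show ?thesis by (simp only: of_real_eq_iff)
qed

text \<open>The sum of the indicators minus the indicator of the union is non-negative and has
  integral 0, hence vanishes almost everywhere.\<close>

lemma AE_indicator_UN_eq_sum:
  fixes A :: "'i \<Rightarrow> 'a set"
  assumes I: "finite I" and A: "\<And>k. k \<in> I \<Longrightarrow> A k \<in> fmeasurable M"
    and eq: "measure M (\<Union>k\<in>I. A k) = (\<Sum>k\<in>I. measure M (A k))"
  shows "AE x in M. (\<Sum>k\<in>I. indicat_real (A k) x) = indicator (\<Union>k\<in>I. A k) x"
proof -
  have UA: "(\<Union>k\<in>I. A k) \<in> fmeasurable M" using I A by (intro fmeasurable.finite_UN)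
  let ?h = "\<lambda>x. (\<Sum>k\<in>I. indicat_real (A k) x) - indicator (\<Union>k\<in>I. A k) x"
  have int: "integrable M ?h"
    using A UA by (intro Bochner_Integration.integrable_diff Bochner_Integration.integrable_sum) 
      (auto intro!: integrable_real_indicator simp: fmeasurable_def)
  have "0 \<le> ?h x" for x
  proof (cases "x \<in> (\<Union>k\<in>I. A k)")
    case True
    then obtain k where "k \<in> I" "x \<in> A k" by blast
    then have "1 \<le> (\<Sum>k\<in>I. indicat_real (A k) x)"
      using member_le_sum[of k I "\<lambda>k. indicat_real (A k) x"] I by simp
    then show ?thesis by (simp add: indicator_def)
  qed (auto intro: sum_nonneg)
  moreover have "integral\<^sup>L M ?h = 0"
    using A UA eq by (subst Bochner_Integration.integral_diff)
      (auto simp: fmeasurable_def Bochner_Integration.integral_sum sets.Int_space_eq2 intro!: integrable_real_indicator)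
  ultimately have "AE x in M. ?h x = 0"
    using integral_nonneg_eq_0_iff_AE[OF int] by simp
  then show ?thesis by eventually_elim simp
qed

text \<open>Subadditivity over the pairs (j, t), each piece being scaled by the determinant. Applied
  to the window equation, it bounds the determinant from below.\<close>

lemma measure_affine_union_le:
  fixes Q :: "real^'k^'k" and T :: "'n::finite \<Rightarrow> real set" and W :: "'n \<Rightarrow> (real^'k) set"
  assumes Q: "Q ** transpose Q = (\<chi> a b. if a = b then (r a)\<^sup>2 else 0)" and r: "\<And>a. r a > 0"
    and W: "\<And>j. compact (W j)" and T: "\<And>j. finite (T j)"
  shows "measure lborel (\<Union>j. \<Union>t\<in>T j. (\<lambda>x. Q *v x + star t) ` W j)
     \<le> \<bar>det Q\<bar> * (\<Sum>j\<in>UNIV. real (card (T j)) * measure lborel (W j))"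
proof -
  have QW: "compact ((\<lambda>x. Q *v x + star t) ` W j)" for t j
    by (intro compact_continuous_image W continuous_intros linear_continuous_on linear_conv_bounded_linear[THEN iffD1]) simp
  have "(\<Union>j. \<Union>t\<in>T j. (\<lambda>x. Q *v x + star t) ` W j) =
      (\<Union>p\<in>Sigma UNIV T. (\<lambda>x. Q *v x + star (snd p)) ` W (fst p))" by force
  then have "measure lborel (\<Union>j. \<Union>t\<in>T j. (\<lambda>x. Q *v x + star t) ` W j) \<le>
      (\<Sum>p\<in>Sigma UNIV T. measure lborel ((\<lambda>x. Q *v x + star (snd p)) ` W (fst p)))"
    using T by (simp only:) (intro measure_UNION_le finite_SigmaI, auto intro: borel_compact QW)
  also have "\<dots> = \<bar>det Q\<bar> * (\<Sum>j\<in>UNIV. real (card (T j)) * measure lborel (W j))"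
    using T by (simp add: measure_affine_image[OF Q r W] sum_distrib_left mult_ac
        flip: sum.Sigma[where g = "\<lambda>j t. \<bar>det Q\<bar> * measure lborel (W j)", unfolded split_def])
  finally show ?thesis .
qed

text \<open>Equality of the volumes makes the pieces of the union pairwise disjoint up to null sets.\<close>

lemma inverse_fourier_affine_union:
  fixes Q :: "real^'k^'k" and T :: "'n::finite \<Rightarrow> real set" and W :: "'n \<Rightarrow> (real^'k) set"
  assumes Q: "Q ** transpose Q = (\<chi> a b. if a = b then (r a)\<^sup>2 else 0)" and r: "\<And>a. r a > 0"
    and W: "\<And>j. compact (W j)" and T: "\<And>j. finite (T j)"
    and vol: "measure lborel (\<Union>j. \<Union>t\<in>T j. (\<lambda>x. Q *v x + star t) ` W j)
       = \<bar>det Q\<bar> * (\<Sum>j\<in>UNIV. real (card (T j)) * measure lborel (W j))"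
  shows "inverse_fourier (indicator (\<Union>j. \<Union>t\<in>T j. (\<lambda>x. Q *v x + star t) ` W j)) y =
     \<bar>det Q\<bar> *\<^sub>R (\<Sum>j\<in>UNIV. (\<Sum>t\<in>T j. exp (2 * of_real pi * \<i> * of_real (star t \<bullet> y))) *
       inverse_fourier (indicator (W j)) (transpose Q *v y))"
proof -
  let ?A = "\<lambda>p. (\<lambda>x. Q *v x + star (snd p)) ` W (fst p)" and ?I = "Sigma UNIV T"
  let ?e = "\<lambda>x y. exp (2 * of_real pi * \<i> * of_real (x \<bullet> y)) :: complex"
  have QW: "compact (?A p)" for p
    by (intro compact_continuous_image W continuous_intros linear_continuous_on linear_conv_bounded_linear[THEN iffD1]) simp
  have un: "(\<Union>j. \<Union>t\<in>T j. (\<lambda>x. Q *v x + star t) ` W j) = (\<Union>p\<in>?I. ?A p)" by force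
  have I: "finite ?I" using T by simp
  note [measurable] = borel_compact[OF QW]
  have [measurable]: "(\<Union>p\<in>?I. ?A p) \<in> sets borel" using I by (intro sets.finite_UN) auto
  \<comment> \<open>Since each piece has its volume scaled by the determinant, the hypothesis on
    volumes says that subadditivity is an equality here.\<close>
  have "measure lborel (\<Union>p\<in>?I. ?A p) = (\<Sum>p\<in>?I. measure lborel (?A p))"
    using T vol unfolding un by (simp add: measure_affine_image[OF Q r W] sum_distrib_left mult_ac
        flip: sum.Sigma[where g = "\<lambda>j t. \<bar>det Q\<bar> * measure lborel (W j)", unfolded split_def])
  moreover have "?A p \<in> fmeasurable lborel" for p
    using emeasure_compact_finite[OF QW[of p]] by (simp add: fmeasurable_def)
  ultimately have "AE x in lborel. (\<Sum>p\<in>?I. indicat_real (?A p) x) = indicator (\<Union>p\<in>?I. ?A p) x"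
    by (intro AE_indicator_UN_eq_sum I)
  then have AE: "AE x in lborel. ?e x y * indicator (\<Union>p\<in>?I. ?A p) x = (\<Sum>p\<in>?I. ?e x y * indicator (?A p) x)"
  proof eventually_elim
    case (elim x)
    then have "complex_of_real (\<Sum>p\<in>?I. indicat_real (?A p) x) = complex_of_real (indicator (\<Union>p\<in>?I. ?A p) x)"
      by simp
    then show ?case by (simp add: of_real_indicator sum_distrib_left[symmetric])
  qed
  have e [measurable]: "(\<lambda>x. ?e x y) \<in> borel_measurable borel"
    by (intro borel_measurable_continuous_onI continuous_intros)
  have int: "integrable lborel (\<lambda>x. ?e x y * indicator (?A p) x)" for p
  proof (rule Bochner_Integration.integrable_bound)
    show "integrable lborel (indicat_real (?A p))"
      using emeasure_compact_finite[OF QW[of p]] by (simp add: integrable_real_indicator)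
    show "AE x in lborel. norm (?e x y * indicator (?A p) x) \<le> norm (indicat_real (?A p) x)"
      by (auto simp: norm_mult norm_exp_eq_Re indicator_def)
  qed simp
  have "inverse_fourier (indicator (\<Union>p\<in>?I. ?A p)) y = (LINT x|lborel. (\<Sum>p\<in>?I. ?e x y * indicator (?A p) x))"
    unfolding inverse_fourier_def using AE by (intro integral_cong_AE) simp_all
  also have "\<dots> = (\<Sum>p\<in>?I. inverse_fourier (indicator (?A p)) y)"
    unfolding inverse_fourier_def by (intro Bochner_Integration.integral_sum int)
  also have "\<dots> = (\<Sum>p\<in>?I. \<bar>det Q\<bar> *\<^sub>R (?e (star (snd p)) y * inverse_fourier (indicator (W (fst p))) (transpose Q *v y)))"
    by (intro sum.cong refl inverse_fourier_affine_image[OF Q r] borel_compact QW W)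
  also have "\<dots> = (\<Sum>j\<in>UNIV. \<Sum>t\<in>T j. \<bar>det Q\<bar> *\<^sub>R (?e (star t) y * inverse_fourier (indicator (W j)) (transpose Q *v y)))"
    using T by (subst sum.Sigma) (simp_all add: split_def)
  finally show ?thesis
    by (simp add: un scaleR_sum_right sum_distrib_right)
qed

text \<open>Dominated convergence: the exponential has modulus 1, so the indicator of the compact
  set is an integrable majorant.\<close>

lemma inverse_fourier_indicator_tendsto_0:
  assumes K: "compact K" and y: "y \<longlonglongrightarrow> 0"
  shows "(\<lambda>n. inverse_fourier (indicator K) (y n)) \<longlonglongrightarrow> complex_of_real (measure lborel K)"
proof -
  note [measurable] = borel_compact[OF K]
  have "(\<lambda>n. inverse_fourier (indicator K) (y n)) \<longlonglongrightarrow> (LINT x|lborel. complex_of_real (indicat_real K x))"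
    unfolding inverse_fourier_def
  proof (rule integral_dominated_convergence[where w = "indicat_real K"])
    show "integrable lborel (indicat_real K)"
      using emeasure_compact_finite[OF K] by (auto intro!: integrable_real_indicator)
    have [measurable]: "(\<lambda>x. exp (2 * of_real pi * \<i> * of_real (x \<bullet> z)) :: complex) \<in> borel_measurable borel" for z :: "real^'a"
      by (intro borel_measurable_continuous_onI continuous_intros)
    show "(\<lambda>x. exp (2 * of_real pi * \<i> * of_real (x \<bullet> y n)) * indicator K x :: complex) \<in> borel_measurable lborel" for n
      by measurable
    show "AE x in lborel. norm (exp (2 * of_real pi * \<i> * of_real (x \<bullet> y n)) * indicator K x :: complex) \<le> indicat_real K x" for n
      by (auto simp: norm_mult norm_exp_eq_Re indicator_def)
    have "(\<lambda>n. exp (2 * of_real pi * \<i> * of_real (x \<bullet> y n)) * indicator K x) \<longlonglongrightarrow>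
       exp (2 * of_real pi * \<i> * of_real (x \<bullet> 0)) * (indicator K x :: complex)" for x
      by (intro tendsto_intros y)
    then show "AE x in lborel. (\<lambda>n. exp (2 * of_real pi * \<i> * of_real (x \<bullet> y n)) * indicator K x) \<longlonglongrightarrow>
        complex_of_real (indicat_real K x)"
      by (simp add: of_real_indicator)
  qed simp
  also have "(LINT x|lborel. complex_of_real (indicat_real K x)) = complex_of_real (measure lborel K)"
    by (subst integral_complex_of_real) simp
  finally show ?thesis .
qed

section \<open>Minimal polynomials and embeddings\<close>

lemma map_poly_of_rat_add:
  "map_poly of_rat (p + q) = (map_poly of_rat p + map_poly of_rat q :: 'a::field_char_0 poly)"
  by (intro poly_eqI) (simp add: coeff_map_poly of_rat_add)

lemma map_poly_of_rat_mult:
  "map_poly of_rat (p * q) = (map_poly of_rat p * map_poly of_rat q :: 'a::field_char_0 poly)"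
  by (intro poly_eqI) (simp add: coeff_map_poly coeff_mult of_rat_sum of_rat_mult)

lemma map_poly_of_int_mult:
  "map_poly of_int (p * q) = (map_poly of_int p * map_poly of_int q :: 'a::{comm_ring_1,ring_char_0} poly)"
  by (intro poly_eqI) (simp add: coeff_map_poly coeff_mult)

lemma map_poly_of_rat_of_int:
  "map_poly of_rat (map_poly of_int p) = (map_poly of_int p :: 'a::field_char_0 poly)"
  by (intro poly_eqI) (simp add: coeff_map_poly)

lemma of_real_of_rat: "of_real (of_rat a) = (of_rat a :: 'a::{real_field,field_char_0})"
  by (cases a) (simp add: of_rat_rat)

lemma poly_map_of_rat_of_real:
  "poly (map_poly of_rat p) (of_real x :: 'a::{real_field,field_char_0}) = of_real (poly (map_poly of_rat p) x)"
  by (induction p) (simp_all add: map_poly_pCons of_real_of_rat)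

section \<open>Integrality and minimal polynomials\<close>

lemma clear_denominators:
  obtains a :: int and q :: "int poly"
  where "a > 0" "map_poly of_int q = smult (of_int a) (p :: rat poly)"
proof -
  have "\<exists>(a::int) q. a > 0 \<and> map_poly of_int q = smult (of_int a) p"
  proof (induction p)
    case 0
    show ?case by (intro exI[of _ 1] exI[of _ 0]) simp
  next
    case (pCons c p)
    then obtain a q where aq: "a > (0::int)" "map_poly of_int q = smult (of_int a) p" by blast
    obtain m n where c: "c = of_int m / of_int n" "n > 0"
      by (metis quotient_of_div quotient_of_denom_pos prod.exhaust)
    have "map_poly of_int (pCons (a * m) (smult n q)) = smult (of_int (a * n)) (pCons c p)"
      using aq c by (simp add: map_poly_pCons map_poly_smult mult_ac)
    then show ?case using aq(1) c(2) by (metis mult_pos_pos)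
  qed
  then show ?thesis using that by blast
qed

text \<open>Gauss's lemma, in terms of contents after clearing denominators.\<close>

lemma abs_coeff_0_monic_factor_le_1:
  fixes p h :: "rat poly" and q :: "int poly"
  assumes p: "lead_coeff p = 1" and q: "coeff q 0 = 1" and eq: "map_poly of_int q = p * h"
  shows "\<bar>coeff p 0\<bar> \<le> 1"
proof -
  obtain a F where F: "a > (0::int)" "map_poly of_int F = smult (of_int a) p"
    by (rule clear_denominators)
  obtain b H where H: "b > (0::int)" "map_poly of_int H = smult (of_int b) h"
    by (rule clear_denominators)
  have "map_poly of_int (F * H) = smult (of_int (a * b)) (map_poly of_int q :: rat poly)"
    by (simp add: map_poly_of_int_mult F H eq mult.commute)
  also have "\<dots> = map_poly of_int (smult (a * b) q)"
    by (simp add: map_poly_smult)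
  finally have FH: "F * H = smult (a * b) q"
    by (simp add: poly_eq_iff coeff_map_poly del: of_int_mult)
  \<comment> \<open>A constant coefficient 1 makes \<open>q\<close> primitive, so the content of
    \<open>F * H\<close> is exactly \<open>a * b\<close>.\<close>
  have "content q dvd 1" using content_dvd_coeff[of q 0] q by simp
  then have "content q = 1" by (metis is_unit_normalize normalize_content)
  then have cont: "content F * content H = a * b"
    using F(1) H(1) by (simp add: FH flip: content_mult)
  have cF: "of_int (coeff F n) = of_int a * coeff p n" for n
    using arg_cong[OF F(2), of "\<lambda>p. coeff p n"] by (simp add: coeff_map_poly)
  \<comment> \<open>The constant coefficients of \<open>F\<close> and \<open>H\<close> multiply to
    the product of the contents. Cancelling \<open>content H\<close> shows that
    \<open>coeff F 0\<close> divides \<open>content F\<close>, hence also the leading coefficient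
    \<open>a\<close>.\<close>
  have "coeff F 0 * content H dvd coeff F 0 * coeff H 0" by simp
  also have "\<dots> = content F * content H"
    using arg_cong[OF FH, of "\<lambda>p. coeff p 0"] q cont by (simp add: coeff_mult)
  finally have "coeff F 0 * content H dvd content F * content H" .
  moreover have "content H \<noteq> 0" using cont F(1) H(1) by force
  ultimately have "coeff F 0 dvd content F" by (metis dvd_mult_cancel_right)
  also have "content F dvd coeff F (degree p)" by simp
  also have "coeff F (degree p) = a" using cF[of "degree p"] p by simp
  finally have "\<bar>coeff F 0\<bar> \<le> a" using F(1) by (metis abs_of_pos dvd_imp_le_int less_irrefl)
  then have "\<bar>of_int (coeff F 0)\<bar> \<le> (of_int a :: rat)" by linarith
  then show ?thesis using F(1) by (simp add: cF abs_mult)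
qed

text \<open>As \<open>min_poly\<close> is a definite description, existence and uniqueness come
  first. A monic rational polynomial of least degree vanishing at \<open>x\<close> divides every
  other one by division with remainder; irreducibility and uniqueness follow.\<close>

lemma
  assumes "algebraic_int x"
  shows lead_coeff_min_poly: "lead_coeff (min_poly x) = 1"
    and poly_min_poly: "poly (map_poly of_rat (min_poly x)) x = 0"
    and min_poly_dvd: "poly (map_poly of_rat q) x = 0 \<Longrightarrow> min_poly x dvd q"
proof -
  define R where "R q \<longleftrightarrow> q \<noteq> 0 \<and> poly (map_poly of_rat q) x = 0" for q
  obtain q\<^sub>0 where q0: "poly (map_poly of_int q\<^sub>0) x = 0" "lead_coeff q\<^sub>0 = 1"
    using assms unfolding algebraic_int_altdef_ipoly by blast
  then have "R (map_poly of_int q\<^sub>0)"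
    by (auto simp: R_def map_poly_of_rat_of_int poly_eq_iff coeff_map_poly intro!: exI[of _ "degree q\<^sub>0"])
  then obtain p\<^sub>0 where p0: "R p\<^sub>0" "\<And>q. R q \<Longrightarrow> degree p\<^sub>0 \<le> degree q"
    using ex_has_least_nat[of R _ degree] by blast
  define p where "p = smult (inverse (lead_coeff p\<^sub>0)) p\<^sub>0"
  have lc: "lead_coeff p = 1" using p0(1) by (simp add: p_def R_def)
  have Rp: "R p" using p0(1) by (simp add: p_def R_def map_poly_smult of_rat_mult)
  have pmin: "degree p \<le> degree q" if "R q" for q
    using p0(2)[OF that] by (simp add: p_def)
  have dvd: "p dvd q" if "poly (map_poly of_rat q) x = 0" for q
  proof (rule ccontr)
    assume "\<not> p dvd q"
    then have nz: "q mod p \<noteq> 0" by (simp add: mod_eq_0_iff_dvd)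
    have "map_poly of_rat q = (map_poly of_rat (q div p) * map_poly of_rat p + map_poly of_rat (q mod p) :: real poly)"
      by (simp flip: map_poly_of_rat_add map_poly_of_rat_mult)
    then have "R (q mod p)" using that Rp nz by (simp add: R_def)
    then have "degree p \<le> degree (q mod p)" by (rule pmin)
    then show False using degree_mod_less[of p q] Rp nz by (auto simp: R_def)
  qed
  have irr: "irreducible p"
  proof (rule irreducibleI)
    show "p \<noteq> 0" using Rp by (simp add: R_def)
    show "\<not> p dvd 1"
    proof
      assume "p dvd 1"
      then obtain q where "p * q = 1" by (metis dvdE)
      then have "map_poly of_rat p * map_poly of_rat q = (1 :: real poly)"
        by (simp flip: map_poly_of_rat_mult)
      then have "poly (map_poly of_rat p) x * poly (map_poly of_rat q) x = 1"
        by (metis poly_1 poly_mult)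
      then show False using Rp by (simp add: R_def)
    qed
    fix a b assume ab: "p = a * b"
    \<comment> \<open>A factor that vanishes at \<open>x\<close> has full degree by minimality, so
      the cofactor is constant.\<close>
    have *: "d dvd 1" if cd: "p = c * d" "poly (map_poly of_rat c) x = 0" for c d
    proof -
      have nz: "c \<noteq> 0" "d \<noteq> 0" using cd Rp by (auto simp: R_def)
      then have "degree p \<le> degree c" using cd by (intro pmin) (simp add: R_def)
      then have "degree d = 0" using cd nz by (simp add: degree_mult_eq)
      then show ?thesis using nz is_unit_iff_degree by blast
    qed
    have "poly (map_poly of_rat a) x * poly (map_poly of_rat b) x = 0"
      using Rp ab by (simp add: R_def map_poly_of_rat_mult)
    then show "a dvd 1 \<or> b dvd 1" using *[of a b] *[of b a] ab by (auto simp: mult.commute)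
  qed
  have "min_poly x = p" unfolding min_poly_def
  proof (rule the_equality)
    show "lead_coeff p = 1 \<and> irreducible p \<and> poly (map_poly of_rat p) x = 0"
      using lc irr Rp by (simp add: R_def)
    fix p' assume p': "lead_coeff p' = 1 \<and> irreducible p' \<and> poly (map_poly of_rat p') x = 0"
    then obtain c where c: "p' = p * c" using dvd by blast
    moreover have "\<not> p dvd 1" using irr by (simp add: irreducible_def)
    ultimately have "c dvd 1" using p' irreducibleD by blast
    then obtain e where e: "c = [:e:]" using is_unit_poly_iff by blast
    then have "e = 1" using c p' lc by (cases "e = 0") auto
    with c e show "p' = p" by simp
  qed
  with lc Rp dvd show "lead_coeff (min_poly x) = 1" "poly (map_poly of_rat (min_poly x)) x = 0"
    "poly (map_poly of_rat q) x = 0 \<Longrightarrow> min_poly x dvd q"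
    by (simp_all add: R_def)
qed

section \<open>Field embeddings and their values at the generator\<close>

lemma rat_adjoin_of_rat: "of_rat c \<in> rat_adjoin x"
  by (auto simp: rat_adjoin_def map_poly_pCons intro!: exI[of _ "[:c:]"])

lemma rat_adjoin_self: "x \<in> rat_adjoin x"
  by (auto simp: rat_adjoin_def map_poly_pCons intro!: exI[of _ "[:0, 1:]"])

lemma rat_adjoin_poly: "poly (map_poly of_rat p) x \<in> rat_adjoin x"
  by (auto simp: rat_adjoin_def)

text \<open>Additivity and the value at 1 settle the naturals and then the integers;
  multiplicativity settles the quotients.\<close>

lemma field_embedding_of_rat:
  fixes \<phi> :: "real \<Rightarrow> 'b::field_char_0"
  assumes "field_embedding (rat_adjoin x) \<phi>"
  shows "\<phi> (of_rat c) = of_rat c"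
proof -
  let ?K = "rat_adjoin x"
  have 1: "\<phi> 1 = 1" and add: "\<And>a b. a \<in> ?K \<Longrightarrow> b \<in> ?K \<Longrightarrow> \<phi> (a + b) = \<phi> a + \<phi> b"
    and mult: "\<And>a b. a \<in> ?K \<Longrightarrow> b \<in> ?K \<Longrightarrow> \<phi> (a * b) = \<phi> a * \<phi> b"
    using assms by (auto simp: field_embedding_def)
  have int: "of_int m \<in> ?K" for m using rat_adjoin_of_rat[of "of_int m" x] by simp
  have nat: "of_nat m \<in> ?K" for m using rat_adjoin_of_rat[of "of_nat m" x] by simp
  have 0: "\<phi> 0 = 0" using add[of 0 0] int[of 0] by simp
  have n: "\<phi> (of_nat m) = of_nat m" for m
  proof (induction m)
    case (Suc m)
    then show ?case using add[of 1 "of_nat m"] nat[of m] int[of 1] 1 by simp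
  qed (simp add: 0)
  have i: "\<phi> (of_int m) = of_int m" for m
  proof (cases m rule: int_cases2)
    case (nonpos k)
    then show ?thesis using add[of "of_int m" "of_nat k"] int[of m] nat[of k] n[of k] 0
      by (simp add: add_eq_0_iff2)
  qed (simp add: n)
  obtain m k where c: "c = of_int m / of_int k" "k > 0"
    by (metis quotient_of_div quotient_of_denom_pos prod.exhaust)
  have "\<phi> (of_rat c) * of_int k = \<phi> (of_rat c * of_int k)"
    using mult[OF rat_adjoin_of_rat int] i by simp
  also have "\<dots> = of_int m" using c by (simp add: of_rat_divide i)
  finally have "\<phi> (of_rat c) = of_int m / of_int k" using c(2) by (simp add: eq_divide_eq)
  also have "\<dots> = of_rat c" using c(1) by (simp add: of_rat_divide)
  finally show ?thesis .
qed

lemma field_embedding_poly: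
  fixes \<phi> :: "real \<Rightarrow> 'b::field_char_0"
  assumes "field_embedding (rat_adjoin x) \<phi>"
  shows "\<phi> (poly (map_poly of_rat p) x) = poly (map_poly of_rat p) (\<phi> x)"
proof (induction p)
  case 0
  show ?case using field_embedding_of_rat[OF assms, of 0] by simp
next
  case (pCons c p)
  let ?K = "rat_adjoin x"
  have add: "\<And>a b. a \<in> ?K \<Longrightarrow> b \<in> ?K \<Longrightarrow> \<phi> (a + b) = \<phi> a + \<phi> b"
    and mult: "\<And>a b. a \<in> ?K \<Longrightarrow> b \<in> ?K \<Longrightarrow> \<phi> (a * b) = \<phi> a * \<phi> b"
    using assms by (auto simp: field_embedding_def)
  have "x * poly (map_poly of_rat p) x \<in> ?K"
    using rat_adjoin_poly[of "pCons 0 p" x] by (simp add: map_poly_pCons)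
  with pCons show ?case
    by (simp add: map_poly_pCons add mult rat_adjoin_of_rat rat_adjoin_self rat_adjoin_poly
        field_embedding_of_rat[OF assms])
qed

text \<open>Elements of the field are rational polynomials in \<open>x\<close>, so the value at
  \<open>x\<close> decides everything there; extensionality decides the rest.\<close>

lemma field_embedding_eqI:
  fixes \<phi> \<psi> :: "real \<Rightarrow> 'b::field_char_0"
  assumes "field_embedding (rat_adjoin x) \<phi>" "field_embedding (rat_adjoin x) \<psi>" "\<phi> x = \<psi> x"
  shows "\<phi> = \<psi>"
proof (rule extensionalityI)
  show "\<phi> \<in> extensional (rat_adjoin x)" "\<psi> \<in> extensional (rat_adjoin x)"
    using assms by (auto simp: field_embedding_def)
  fix y assume "y \<in> rat_adjoin x"
  then show "\<phi> y = \<psi> y" using assms by (auto simp: rat_adjoin_def field_embedding_poly)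
qed

lemma field_embedding_root:
  fixes \<phi> :: "real \<Rightarrow> 'b::field_char_0"
  assumes "field_embedding (rat_adjoin x) \<phi>" "poly (map_poly of_rat p) x = 0"
  shows "poly (map_poly of_rat p) (\<phi> x) = 0"
  using field_embedding_poly[OF assms(1), of p] field_embedding_of_rat[OF assms(1), of 0] assms(2) by simp

text \<open>A real value at the generator would make every value of the embedding real.\<close>

lemma nonreal_embedding_not_real:
  assumes "\<phi> \<in> nonreal_embeddings (rat_adjoin x)"
  shows "\<phi> x \<notin> \<real>"
proof
  assume "\<phi> x \<in> \<real>"
  then obtain t where t: "\<phi> x = complex_of_real t" by (auto elim: Reals_cases)
  have \<phi>: "field_embedding (rat_adjoin x) \<phi>" "\<not> \<phi> ` rat_adjoin x \<subseteq> \<real>"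
    using assms by (auto simp: nonreal_embeddings_def)
  from \<phi>(1) have "\<phi> ` rat_adjoin x \<subseteq> \<real>"
    by (auto simp: rat_adjoin_def field_embedding_poly t poly_map_of_rat_of_real)
  with \<phi>(2) show False by simp
qed

text \<open>The conjugate of \<open>x\<close> belonging to a coordinate label: \<open>ReC i\<close> and \<open>ImC i\<close> stand for the
  pair \<open>\<sigma> i x\<close>, \<open>cnj (\<sigma> i x)\<close>.\<close>

fun conjugate :: "(nat \<Rightarrow> real \<Rightarrow> real) \<Rightarrow> (nat \<Rightarrow> real \<Rightarrow> complex) \<Rightarrow> real \<Rightarrow> coord \<Rightarrow> complex" where
  "conjugate \<kappa> \<sigma> x (RealC i) = complex_of_real (\<kappa> i x)"
| "conjugate \<kappa> \<sigma> x (ReC i) = \<sigma> i x"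
| "conjugate \<kappa> \<sigma> x (ImC i) = cnj (\<sigma> i x)"

lemma finite_coord_labels: "finite (coord_labels r s)"
  by (simp add: coord_labels_def)

lemma sum_coord_labels:
  "(\<Sum>l\<in>coord_labels r s. g l) = (\<Sum>i=2..r. g (RealC i)) + (\<Sum>i=1..s. g (ReC i)) + (\<Sum>i=1..s. g (ImC i))"
  unfolding coord_labels_def
  by (subst sum.union_disjoint sum.reindex; auto simp: inj_on_def)+

section \<open>Conjugates listed by an embedding system\<close>

context
  fixes x :: real and r s :: nat and \<kappa> :: "nat \<Rightarrow> real \<Rightarrow> real" and \<sigma> :: "nat \<Rightarrow> real \<Rightarrow> complex"
  assumes es: "embedding_system x r s \<kappa> \<sigma>"
begin

text \<open>The identity is a real embedding and must be listed, so the index range is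
  non-empty.\<close>

lemma embedding_system_pos: "r \<ge> 1"
proof -
  have "restrict id (rat_adjoin x) \<in> real_embeddings (rat_adjoin x)"
  proof -
    have "a + b \<in> rat_adjoin x" "a * b \<in> rat_adjoin x" if "a \<in> rat_adjoin x" "b \<in> rat_adjoin x" for a b
      using that unfolding rat_adjoin_def
      by (auto simp flip: poly_add poly_mult map_poly_of_rat_add map_poly_of_rat_mult)
    moreover have "1 \<in> rat_adjoin x" using rat_adjoin_of_rat[of 1 x] by simp
    ultimately show ?thesis by (auto simp: real_embeddings_def field_embedding_def)
  qed
  moreover have "\<kappa> ` {1..r} = real_embeddings (rat_adjoin x)"
    using es by (auto simp: embedding_system_def bij_betw_def)
  ultimately show ?thesis by (metis atLeastatMost_empty_iff image_empty empty_iff)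
qed

lemma real_embedding: "i \<in> {1..r} \<Longrightarrow> field_embedding (rat_adjoin x) (\<kappa> i)"
  using es by (auto simp: embedding_system_def bij_betw_def real_embeddings_def)

lemma nonreal_embedding:
  assumes "i \<in> {1..s}"
  shows "\<sigma> i \<in> nonreal_embeddings (rat_adjoin x)"
    and "compose (rat_adjoin x) cnj (\<sigma> i) \<in> nonreal_embeddings (rat_adjoin x)"
proof -
  let ?g = "\<lambda>(i, conj). if conj then compose (rat_adjoin x) cnj (\<sigma> i) else \<sigma> i"
  have "?g ` ({1..s} \<times> UNIV) = nonreal_embeddings (rat_adjoin x)"
    using es by (simp add: embedding_system_def bij_betw_def)
  moreover have "?g (i, False) \<in> ?g ` ({1..s} \<times> UNIV)" "?g (i, True) \<in> ?g ` ({1..s} \<times> UNIV)"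
    using assms by blast+
  ultimately show "\<sigma> i \<in> nonreal_embeddings (rat_adjoin x)"
    "compose (rat_adjoin x) cnj (\<sigma> i) \<in> nonreal_embeddings (rat_adjoin x)" by simp_all
qed

text \<open>Embeddings that agree at \<open>x\<close> coincide, so the absence of repetitions in the
  list passes to the values at \<open>x\<close>.\<close>

lemma nonreal_embeddings_distinct:
  assumes "i \<in> {1..s}" "j \<in> {1..s}"
  shows "\<sigma> i x = \<sigma> j x \<Longrightarrow> i = j" "\<sigma> i x \<noteq> cnj (\<sigma> j x)"
proof -
  let ?g = "\<lambda>(i, conj). if conj then compose (rat_adjoin x) cnj (\<sigma> i) else \<sigma> i"
  have inj: "inj_on ?g ({1..s} \<times> UNIV)"
    using es by (simp add: embedding_system_def bij_betw_def)
  have emb: "field_embedding (rat_adjoin x) (\<sigma> i)" "field_embedding (rat_adjoin x) (\<sigma> j)"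
     "field_embedding (rat_adjoin x) (compose (rat_adjoin x) cnj (\<sigma> j))"
    using nonreal_embedding assms by (auto simp: nonreal_embeddings_def)
  show "i = j" if "\<sigma> i x = \<sigma> j x"
    using inj_onD[OF inj, of "(i, False)" "(j, False)"] field_embedding_eqI[OF emb(1,2) that] assms by simp
  show "\<sigma> i x \<noteq> cnj (\<sigma> j x)"
  proof
    assume "\<sigma> i x = cnj (\<sigma> j x)"
    then have "\<sigma> i x = compose (rat_adjoin x) cnj (\<sigma> j) x"
      by (simp add: compose_def rat_adjoin_self)
    then show False
      using inj_onD[OF inj, of "(i, False)" "(j, True)"] field_embedding_eqI[OF emb(1,3)] assms by simp
  qed
qed

text \<open>Imaginary parts separate real from non-real conjugates; within each kind, different
  embeddings differ at \<open>x\<close>. The label \<open>RealC 1\<close>, which is no coordinate of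
  internal space, is added to account for \<open>x\<close> itself.\<close>

lemma inj_on_conjugate: "inj_on (conjugate \<kappa> \<sigma> x) (insert (RealC 1) (coord_labels r s))"
proof -
  have inj: "inj_on \<kappa> {1..r}"
    using es by (simp add: embedding_system_def bij_betw_def)
  have real: "i = j" if "i \<in> {1..r}" "j \<in> {1..r}" "\<kappa> i x = \<kappa> j x" for i j
  proof -
    have "\<kappa> i = \<kappa> j" using field_embedding_eqI[OF real_embedding real_embedding] that by blast
    then show ?thesis using inj that by (simp add: inj_onD)
  qed
  have nr: "Im (\<sigma> j x) \<noteq> 0" if "j \<in> {1..s}" for j
    using nonreal_embedding_not_real[OF nonreal_embedding(1)[OF that]] complex_is_Real_iff by blast
  have *: "insert (RealC 1) (coord_labels r s) = RealC ` {1..r} \<union> ReC ` {1..s} \<union> ImC ` {1..s}"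
    using embedding_system_pos by (auto simp: coord_labels_def image_iff)
  show ?thesis unfolding *
  proof (rule inj_onI)
    fix l m
    assume lm: "l \<in> RealC ` {1..r} \<union> ReC ` {1..s} \<union> ImC ` {1..s}"
      "m \<in> RealC ` {1..r} \<union> ReC ` {1..s} \<union> ImC ` {1..s}"
      and eq: "conjugate \<kappa> \<sigma> x l = conjugate \<kappa> \<sigma> x m"
    have im: "Im (conjugate \<kappa> \<sigma> x l) = Im (conjugate \<kappa> \<sigma> x m)" by (simp only: eq)
    note distinct = nonreal_embeddings_distinct
    show "l = m"
    proof (cases l)
      case l: (RealC i)
      then have i: "i \<in> {1..r}" using lm(1) by blast
      show ?thesis
      proof (cases m)
        case m: (RealC j)
        then have j: "j \<in> {1..r}" using lm(2) by blast
        have "\<kappa> i x = \<kappa> j x" using eq by (simp only: l m conjugate.simps of_real_eq_iff)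
        then show ?thesis using real[OF i j] by (simp only: l m)
      next
        case m: (ReC j)
        then have j: "j \<in> {1..s}" using lm(2) by blast
        show ?thesis using nr[OF j] im by (simp only: l m conjugate.simps Im_complex_of_real)
      next
        case m: (ImC j)
        then have j: "j \<in> {1..s}" using lm(2) by blast
        show ?thesis using nr[OF j] im
          by (simp only: l m conjugate.simps Im_complex_of_real neg_0_equal_iff_equal cnj.sel)
      qed
    next
      case l: (ReC i)
      then have i: "i \<in> {1..s}" using lm(1) by blast
      show ?thesis
      proof (cases m)
        case m: (RealC j)
        show ?thesis using nr[OF i] im by (simp only: l m conjugate.simps Im_complex_of_real)
      next
        case m: (ReC j)
        then have j: "j \<in> {1..s}" using lm(2) by blast
        show ?thesis using distinct(1)[OF i j] eq by (simp only: l m conjugate.simps)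
      next
        case m: (ImC j)
        then have j: "j \<in> {1..s}" using lm(2) by blast
        show ?thesis using distinct(2)[OF i j] eq by (simp only: l m conjugate.simps)
      qed
    next
      case l: (ImC i)
      then have i: "i \<in> {1..s}" using lm(1) by blast
      show ?thesis
      proof (cases m)
        case m: (RealC j)
        show ?thesis using nr[OF i] im
          by (simp only: l m conjugate.simps Im_complex_of_real neg_equal_0_iff_equal cnj.sel)
      next
        case m: (ReC j)
        then have j: "j \<in> {1..s}" using lm(2) by blast
        have "\<sigma> j x = cnj (\<sigma> i x)" using eq by (simp only: l m conjugate.simps)
        then show ?thesis using distinct(2)[OF j i] by blast
      next
        case m: (ImC j)
        then have j: "j \<in> {1..s}" using lm(2) by blast
        have "\<sigma> i x = \<sigma> j x" using eq by (simp only: l m conjugate.simps complex_cnj_cancel_iff)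
        then show ?thesis using distinct(1)[OF i j] by (simp only: l m)
      qed
    qed
  qed
qed

lemma conjugate_root:
  assumes "l \<in> insert (RealC 1) (coord_labels r s)" "poly (map_poly of_rat p) x = 0"
  shows "poly (map_poly of_rat p) (conjugate \<kappa> \<sigma> x l) = 0"
proof (cases l)
  case (RealC i)
  then have "i \<in> {1..r}" using assms embedding_system_pos by (auto simp: coord_labels_def)
  from field_embedding_root[OF real_embedding[OF this] assms(2)] show ?thesis
    by (simp add: RealC poly_map_of_rat_of_real)
next
  case (ReC i)
  then have "i \<in> {1..s}" using assms by (auto simp: coord_labels_def)
  from nonreal_embedding(1)[OF this] field_embedding_root[OF _ assms(2), of "\<sigma> i"] show ?thesis
    by (simp add: ReC nonreal_embeddings_def)
next
  case (ImC i)
  then have "i \<in> {1..s}" using assms by (auto simp: coord_labels_def)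
  from nonreal_embedding(2)[OF this] field_embedding_root[OF _ assms(2), of "compose (rat_adjoin x) cnj (\<sigma> i)"]
  show ?thesis by (simp add: ImC nonreal_embeddings_def compose_def rat_adjoin_self)
qed

lemma card_conjugate_labels: "card (insert (RealC 1) (coord_labels r s)) = r + 2 * s"
proof -
  have "card (coord_labels r s) = (r - 1) + 2 * s"
    using sum_coord_labels[of "\<lambda>_. 1::nat" r s] by simp
  moreover have "RealC 1 \<notin> coord_labels r s" by (auto simp: coord_labels_def)
  ultimately show ?thesis using embedding_system_pos by (simp add: finite_coord_labels)
qed

lemma conjugate_1: "conjugate \<kappa> \<sigma> x (RealC 1) = complex_of_real x"
  using es by (simp add: embedding_system_def rat_adjoin_self)

text \<open>Both sides are monic of degree \<open>r + 2 * s\<close> and vanish at the same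
  \<open>r + 2 * s\<close> distinct points, the conjugates.\<close>

lemma map_poly_min_poly_eq_prod:
  assumes "algebraic_int x" and deg: "degree (min_poly x) = r + 2 * s"
  shows "map_poly of_rat (min_poly x) =
    (\<Prod>l\<in>insert (RealC 1) (coord_labels r s). [:- conjugate \<kappa> \<sigma> x l, 1:])"
    (is "?P = (\<Prod>l\<in>?L. ?f l)")
proof (rule poly_eqI_degree_lead_coeff)
  have degp: "degree (\<Prod>l\<in>?L. ?f l) = r + 2 * s"
    using card_conjugate_labels by (subst degree_prod_eq_sum_degree) auto
  have "lead_coeff (\<Prod>l\<in>?L. ?f l) = 1" by (simp only: lead_coeff_prod) simp
  with degp show "coeff ?P (r + 2 * s) = coeff (\<Prod>l\<in>?L. ?f l) (r + 2 * s)"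
    using lead_coeff_min_poly[OF assms(1)] deg by (simp add: coeff_map_poly)
  show "r + 2 * s \<le> card (conjugate \<kappa> \<sigma> x ` ?L)"
    by (simp only: card_image[OF inj_on_conjugate] card_conjugate_labels)
  show "degree ?P \<le> r + 2 * s" using deg by (simp add: degree_map_poly)
  show "degree (\<Prod>l\<in>?L. ?f l) \<le> r + 2 * s" using degp by simp
  fix z assume "z \<in> conjugate \<kappa> \<sigma> x ` ?L"
  then obtain l where l: "l \<in> ?L" "z = conjugate \<kappa> \<sigma> x l" by blast
  have "poly (\<Prod>l\<in>?L. ?f l) z = 0"
    using l by (simp only: poly_prod prod_zero_iff finite_insert finite_coord_labels) auto
  then show "poly ?P z = poly (\<Prod>l\<in>?L. ?f l) z"
    using conjugate_root[OF l(1) poly_min_poly[OF assms(1)]] l(2) by simp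
qed

text \<open>Up to sign, the constant coefficient of the minimal polynomial is the product of all
  conjugates. Integrality of \<open>inverse x\<close> bounds it by 1 through Gauss's lemma.\<close>

lemma pv_unit_conjugates:
  assumes pv: "pv_unit x" and deg: "degree (min_poly x) = r + 2 * s"
  shows "x * (\<Prod>l\<in>coord_labels r s. cmod (conjugate \<kappa> \<sigma> x l)) \<le> 1"
    and "l \<in> coord_labels r s \<Longrightarrow> conjugate \<kappa> \<sigma> x l \<noteq> 0"
    and "l \<in> coord_labels r s \<Longrightarrow> cmod (conjugate \<kappa> \<sigma> x l) < 1"
proof -
  have x: "x > 1" "algebraic_int x" "algebraic_int (inverse x)"
    "\<And>z. z \<in> alg_conjugates x \<Longrightarrow> z \<noteq> complex_of_real x \<Longrightarrow> cmod z < 1"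
    using pv by (auto simp: pv_unit_def)
  obtain q\<^sub>0 where q0: "poly (map_poly of_int q\<^sub>0) (inverse x) = 0" "lead_coeff q\<^sub>0 = 1"
    using x(3) unfolding algebraic_int_altdef_ipoly by blast
  \<comment> \<open>Reversing a monic integer polynomial that vanishes at \<open>inverse x\<close>
    gives one that vanishes at \<open>x\<close> and has constant coefficient 1. The latter also
    excludes 0 as a conjugate.\<close>
  define q where "q = reflect_poly q\<^sub>0"
  have "map_poly of_int q = (reflect_poly (map_poly of_int q\<^sub>0) :: real poly)"
    by (intro poly_eqI) (simp add: q_def coeff_map_poly coeff_reflect_poly degree_map_poly)
  then have q: "poly (map_poly of_rat (map_poly of_int q)) x = 0" "coeff q 0 = 1"
    using q0 x(1) by (simp_all add: map_poly_of_rat_of_int poly_reflect_poly_nz q_def)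
  from min_poly_dvd[OF x(2) q(1)] obtain h where "map_poly of_int q = min_poly x * h" by blast
  from abs_coeff_0_monic_factor_le_1[OF lead_coeff_min_poly[OF x(2)] q(2) this]
  have le: "\<bar>coeff (min_poly x) 0\<bar> \<le> 1" .
  have one: "RealC 1 \<notin> coord_labels r s" by (auto simp: coord_labels_def)
  have "complex_of_real (of_rat (coeff (min_poly x) 0)) = poly (map_poly of_rat (min_poly x)) 0"
    by (simp add: poly_0_coeff_0 coeff_map_poly of_real_of_rat)
  also have "\<dots> = - complex_of_real x * (\<Prod>l\<in>coord_labels r s. - conjugate \<kappa> \<sigma> x l)"
    unfolding map_poly_min_poly_eq_prod[OF x(2) deg] poly_prod
    using one conjugate_1 by (simp add: finite_coord_labels)
  finally have "cmod (complex_of_real (of_rat (coeff (min_poly x) 0))) =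
    cmod (- complex_of_real x * (\<Prod>l\<in>coord_labels r s. - conjugate \<kappa> \<sigma> x l))" by simp
  then have "\<bar>of_rat (coeff (min_poly x) 0)\<bar> = x * (\<Prod>l\<in>coord_labels r s. cmod (conjugate \<kappa> \<sigma> x l))"
    using x(1) by (simp add: norm_mult flip: prod_norm)
  moreover have "\<bar>of_rat (coeff (min_poly x) 0) :: real\<bar> \<le> 1"
    using le by (metis abs_of_rat of_rat_1 of_rat_less_eq)
  ultimately show "x * (\<Prod>l\<in>coord_labels r s. cmod (conjugate \<kappa> \<sigma> x l)) \<le> 1" by simp
  show "conjugate \<kappa> \<sigma> x l \<noteq> 0" if l: "l \<in> coord_labels r s"
  proof
    assume "conjugate \<kappa> \<sigma> x l = 0"
    then show False using conjugate_root[OF _ q(1), of l] l q(2)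
      by (simp add: poly_0_coeff_0 coeff_map_poly)
  qed
  show "cmod (conjugate \<kappa> \<sigma> x l) < 1" if l: "l \<in> coord_labels r s"
  proof (rule x(4))
    show "conjugate \<kappa> \<sigma> x l \<in> alg_conjugates x"
      using conjugate_root[OF _ poly_min_poly[OF x(2)]] l by (simp add: alg_conjugates_def)
    \<comment> \<open>The PV condition exempts \<open>x\<close> itself; by injectivity only the
      label \<open>RealC 1\<close> yields it.\<close>
    show "conjugate \<kappa> \<sigma> x l \<noteq> complex_of_real x"
      using inj_onD[OF inj_on_conjugate, of l "RealC 1"] l one conjugate_1 by (metis insertI1 insertI2)
  qed
qed

end

section \<open>The internal renormalisation\<close>

text \<open>A block representing multiplication by a complex number z has two orthogonal rows of
  length |z|, and different blocks share no columns.\<close>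

lemma star_matrix_mult_transpose:
  assumes lab: "bij_betw lab UNIV (coord_labels r s)"
  shows "star_matrix lab \<kappa> \<sigma> x ** transpose (star_matrix lab \<kappa> \<sigma> x) =
    (\<chi> a b. if a = b then (cmod (conjugate \<kappa> \<sigma> x (lab a)))\<^sup>2 else 0)"
proof -
  \<comment> \<open>Entries as functions of labels, so that the sum over indices can be carried
    along \<open>lab\<close> to the explicit label set.\<close>
  define q where "q = (\<lambda>l m. case (l, m) of
      (RealC i, RealC j) \<Rightarrow> if i = j then \<kappa> i x else 0
    | (ReC i, ReC j) \<Rightarrow> if i = j then Re (\<sigma> i x) else 0
    | (ReC i, ImC j) \<Rightarrow> if i = j then - Im (\<sigma> i x) else 0
    | (ImC i, ReC j) \<Rightarrow> if i = j then Im (\<sigma> i x) else 0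
    | (ImC i, ImC j) \<Rightarrow> if i = j then Re (\<sigma> i x) else 0
    | _ \<Rightarrow> 0)"
  have key: "(\<Sum>c\<in>coord_labels r s. q l c * q m c) = (if l = m then (cmod (conjugate \<kappa> \<sigma> x l))\<^sup>2 else 0)"
    if "l \<in> coord_labels r s" "m \<in> coord_labels r s" for l m
    using that unfolding sum_coord_labels
    by (cases l; cases m) (auto simp: q_def coord_labels_def cmod_power2
        if_distrib[of "\<lambda>x. _ * x"] if_distrib[of "\<lambda>x. x * _"] cong: if_cong simp flip: power2_eq_square)
  have lab_in: "lab a \<in> coord_labels r s" and lab_eq: "lab a = lab b \<longleftrightarrow> a = b" for a b
    using lab by (auto simp: bij_betw_def inj_on_def)
  have "(star_matrix lab \<kappa> \<sigma> x ** transpose (star_matrix lab \<kappa> \<sigma> x)) $ a $ b =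
      (\<Sum>c\<in>UNIV. q (lab a) (lab c) * q (lab b) (lab c))" for a b
    by (simp add: matrix_matrix_mult_def transpose_def star_matrix_def q_def)
  also have "\<dots> a b = (\<Sum>c\<in>coord_labels r s. q (lab a) c * q (lab b) c)" for a b
    using sum.reindex_bij_betw[OF lab, of "\<lambda>c. q (lab a) c * q (lab b) c"] by simp
  finally show ?thesis by (simp add: vec_eq_iff key lab_in lab_eq)
qed

text \<open>As \<open>Q Q\<^sup>T\<close> is diagonal with entries below 1, the transpose of \<open>Q\<close> is a contraction.\<close>

lemma transpose_orthogonal_rows_funpow_tendsto_0:
  fixes Q :: "real^'k^'k"
  assumes Q: "Q ** transpose Q = (\<chi> a b. if a = b then (r a)\<^sup>2 else 0)"
    and r: "\<And>a. r a \<ge> 0" "\<And>a. r a < 1"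
  shows "(\<lambda>n. ((*v) (transpose Q) ^^ n) y) \<longlonglongrightarrow> 0"
proof -
  define \<theta> where "\<theta> = Max (range r)"
  have \<theta>: "r a \<le> \<theta>" for a unfolding \<theta>_def by (intro Max_ge) auto
  have \<theta>1: "\<theta> < 1" using r(2) by (simp add: \<theta>_def)
  have \<theta>0: "\<theta> \<ge> 0" using r(1) \<theta> order_trans by blast
  have "norm (transpose Q *v z) \<le> \<theta> * norm z" for z
  proof (rule power2_le_imp_le)
    \<comment> \<open>The squared norm is a quadratic form in \<open>Q ** transpose Q\<close>, which
      is diagonal.\<close>
    have "(norm (transpose Q *v z))\<^sup>2 = z \<bullet> ((Q ** transpose Q) *v z)"
      using dot_lmul_matrix[of z Q "transpose Q *v z"]
      by (simp add: power2_norm_eq_inner flip: matrix_vector_mul_assoc)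
    also have "\<dots> = (\<Sum>a\<in>UNIV. (r a)\<^sup>2 * (z $ a)\<^sup>2)"
      unfolding Q by (simp add: inner_vec_def matrix_vector_mult_def power2_eq_square
          if_distrib[of "\<lambda>x. x * _"] if_distrib[of "\<lambda>x. _ * x"] mult_ac cong: if_cong)
    also have "\<dots> \<le> (\<Sum>a\<in>UNIV. \<theta>\<^sup>2 * (z $ a)\<^sup>2)"
      using r(1) \<theta> by (intro sum_mono mult_right_mono power_mono) auto
    also have "\<dots> = (\<theta> * norm z)\<^sup>2"
      unfolding power_mult_distrib power2_norm_eq_inner inner_vec_def
      by (simp add: power2_eq_square sum_distrib_left)
    finally show "(norm (transpose Q *v z))\<^sup>2 \<le> (\<theta> * norm z)\<^sup>2" .
    show "0 \<le> \<theta> * norm z" using \<theta>0 by simp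
  qed
  then have le: "norm (((*v) (transpose Q) ^^ n) y) \<le> \<theta> ^ n * norm y" for n
  proof (induction n)
    case (Suc n)
    have "norm (((*v) (transpose Q) ^^ Suc n) y) \<le> \<theta> * norm (((*v) (transpose Q) ^^ n) y)"
      using Suc.prems by simp
    also have "\<dots> \<le> \<theta> * (\<theta> ^ n * norm y)" using Suc \<theta>0 by (intro mult_left_mono) blast+
    finally show ?case by (simp only: power_Suc mult.assoc)
  qed simp
  have "(\<lambda>n. \<theta> ^ n * norm y) \<longlonglongrightarrow> 0"
    using \<theta>0 \<theta>1 by (intro tendsto_mult_left_zero LIMSEQ_power_zero) simp
  then show ?thesis by (rule Lim_null_comparison[OF always_eventually[OF allI[OF le]]])
qed

text \<open>Iterating the functional equation expresses \<open>f y\<close> by \<open>P n y\<close>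
  applied to the value at the n-th orbit point. These values tend to \<eta> times \<open>v\<close>
  and the matrices stay bounded, so the values may be replaced by their limit.\<close>

lemma scaled_cocycle_fixed_vector_tendsto:
  fixes T :: "'n::finite \<Rightarrow> 'n \<Rightarrow> real set" and v :: "real^'n" and R :: "real^'k^'k"
    and star :: "real \<Rightarrow> real^'k" and \<beta> :: real and f :: "real^'k \<Rightarrow> complex^'n"
  defines "P \<equiv> \<lambda>n y. \<beta> ^ n *\<^sub>R internal_cocycle star T R n y"
  assumes \<beta>: "\<beta> > 0" and v: "\<And>i. v $ i > 0" and \<eta>: "\<eta> > 0"
    and Mv: "\<And>i. \<beta> * (\<Sum>j\<in>UNIV. real (card (T i j)) * v $ j) = v $ i"
    and f: "\<And>z i. f z $ i = \<beta> *\<^sub>R (\<Sum>j\<in>UNIV. internal_fourier_matrix star T z $ i $ j * f (R *v z) $ j)"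
    and lim: "\<And>j. (\<lambda>n. f (((*v) R ^^ n) y) $ j) \<longlonglongrightarrow> complex_of_real (\<eta> * v $ j)"
  shows "(\<lambda>n. P n y *v complexify_vec v) \<longlonglongrightarrow> complex_of_real (1 / \<eta>) *s f y"
proof (rule vec_tendstoI)
  fix i
  have iter: "f y $ i = (\<Sum>j\<in>UNIV. P n y $ i $ j * f (((*v) R ^^ n) y) $ j)" for n
  proof (induction n)
    case 0
    have "(\<Sum>j\<in>UNIV. P 0 y $ i $ j * f (((*v) R ^^ 0) y) $ j) = (\<Sum>j\<in>UNIV. if j = i then f y $ j else 0)"
      by (intro sum.cong) (auto simp: P_def mat_def)
    then show ?case by simp
  next
    case (Suc n)
    let ?z = "((*v) R ^^ n) y"
    have "f y $ i = (\<Sum>l\<in>UNIV. P n y $ i $ l *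
        (\<beta> *\<^sub>R (\<Sum>j\<in>UNIV. internal_fourier_matrix star T ?z $ l $ j * f (R *v ?z) $ j)))"
      unfolding f[symmetric] by (rule Suc)
    also have "\<dots> = (\<Sum>j\<in>UNIV. P (Suc n) y $ i $ j * f (R *v ?z) $ j)"
      unfolding P_def scaleR_sum_right sum_distrib_left internal_cocycle.simps vector_scaleR_component
        matrix_mult_entry sum_distrib_right
      by (subst sum.swap) (simp add: mult_ac)
    finally show ?case by simp
  qed
  have bound: "norm (P n y $ i $ j) \<le> v $ i / v $ j" for n j
  proof -
    have "norm (P n y $ i $ j) * v $ j \<le> (\<Sum>j\<in>UNIV. norm (P n y $ i $ j) * v $ j)"
      using v by (intro member_le_sum[where f = "\<lambda>j. norm (P n y $ i $ j) * v $ j"]) (auto simp: less_imp_le)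
    also have "\<dots> \<le> v $ i"
      unfolding P_def by (intro internal_cocycle_row_sum_le v Mv less_imp_le[OF \<beta>])
    finally show ?thesis using v[of j] by (simp add: field_simps)
  qed
  have "(\<lambda>n. \<Sum>j\<in>UNIV. P n y $ i $ j * (f (((*v) R ^^ n) y) $ j - complex_of_real (\<eta> * v $ j))) \<longlonglongrightarrow> (\<Sum>j::'n\<in>UNIV. 0)"
  proof (rule tendsto_sum)
    fix j
    have "(\<lambda>n. f (((*v) R ^^ n) y) $ j - complex_of_real (\<eta> * v $ j)) \<longlonglongrightarrow> 0"
      using lim[of j] by (simp add: LIM_zero_iff)
    then have 0: "(\<lambda>n. v $ i / v $ j * norm (f (((*v) R ^^ n) y) $ j - complex_of_real (\<eta> * v $ j))) \<longlonglongrightarrow> 0"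
      by (intro tendsto_mult_right_zero tendsto_norm_zero)
    have le: "norm (P n y $ i $ j * (f (((*v) R ^^ n) y) $ j - complex_of_real (\<eta> * v $ j)))
      \<le> v $ i / v $ j * norm (f (((*v) R ^^ n) y) $ j - complex_of_real (\<eta> * v $ j))" for n
      by (simp only: norm_mult) (intro mult_right_mono bound norm_ge_zero)
    show "(\<lambda>n. P n y $ i $ j * (f (((*v) R ^^ n) y) $ j - complex_of_real (\<eta> * v $ j))) \<longlonglongrightarrow> 0"
      by (rule Lim_null_comparison[OF always_eventually[OF allI[OF le]] 0])
  qed
  \<comment> \<open>By \<open>iter\<close>, the first part of the difference is
    \<open>f y $ i\<close> for every n.\<close>
  also have "(\<lambda>n. \<Sum>j\<in>UNIV. P n y $ i $ j * (f (((*v) R ^^ n) y) $ j - complex_of_real (\<eta> * v $ j))) =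
      (\<lambda>n. f y $ i - complex_of_real \<eta> * (P n y *v complexify_vec v) $ i)"
    by (simp add: fun_eq_iff right_diff_distrib sum_subtractf matrix_vector_mult_def complexify_vec_def
        sum_distrib_left mult_ac flip: iter)
  finally have "(\<lambda>n. f y $ i - (f y $ i - complex_of_real \<eta> * (P n y *v complexify_vec v) $ i)) \<longlonglongrightarrow> f y $ i - 0"
    by (intro tendsto_intros) simp
  then have "(\<lambda>n. complex_of_real (1 / \<eta>) * (complex_of_real \<eta> * (P n y *v complexify_vec v) $ i))
      \<longlonglongrightarrow> complex_of_real (1 / \<eta>) * f y $ i"
    by (intro tendsto_intros) simp
  then show "(\<lambda>n. (P n y *v complexify_vec v) $ i) \<longlonglongrightarrow> (complex_of_real (1 / \<eta>) *s f y) $ i"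
    using \<eta> by simp
qed

section \<open>The limit matrix and the transforms of the windows\<close>

theorem corollary4p7:
  fixes \<rho> :: "'n::finite \<Rightarrow> 'n list"
    and M :: "real^'n^'n" and lam :: real and d r s :: nat
    and v u :: "real^'n" and c\<^sub>0 :: real and len :: "'n \<Rightarrow> real" and w :: "int \<Rightarrow> 'n"
    and \<kappa> :: "nat \<Rightarrow> real \<Rightarrow> real" and \<sigma> :: "nat \<Rightarrow> real \<Rightarrow> complex"
    and lab :: "'k::finite \<Rightarrow> coord"
    and star :: "real \<Rightarrow> real^'k" and Q R :: "real^'k^'k" and \<beta> \<eta> :: real
    and T :: "'n \<Rightarrow> 'n \<Rightarrow> real set" and W :: "'n \<Rightarrow> (real^'k) set"
    and C :: "real^'k \<Rightarrow> complex^'n^'n" and f :: "real^'k \<Rightarrow> complex^'n"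
  assumes "primitive_subst \<rho>"
    and "M = subst_matrix \<rho>"
    and "is_pf_eigenvalue M lam"
    and "pv_unit lam"
    and "d = degree (min_poly lam)" and "d \<le> CARD('n)"
    and "\<forall>i. v $ i > 0" and "M *v v = lam *s v"
    and "\<forall>i. u $ i > 0" and "u v* M = lam *s u"
    and "(\<Sum>i\<in>UNIV. v $ i) = 1" and "(\<Sum>i\<in>UNIV. u $ i * v $ i) = 1"
    and "c\<^sub>0 > 0" and "\<forall>i. len i = c\<^sub>0 * u $ i"
    and "w \<in> subst_hull \<rho>" and "control_points_generate lam len w"
    and "T = displacements \<rho> len"
    and "embedding_system lam r s \<kappa> \<sigma>" and "d = r + 2 * s"
    and "bij_betw lab UNIV (coord_labels r s)"
    and "star = star_map lab \<kappa> \<sigma>"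
    and "Q = star_matrix lab \<kappa> \<sigma> lam" and "R = transpose Q" and "\<beta> = \<bar>det R\<bar>"
    and "\<forall>i. W i \<noteq> {} \<and> compact (W i)"
    and "\<forall>i. W i = (\<Union>j. \<Union>t\<in>T i j. (\<lambda>x. Q *v x + star t) ` W j)"
    and "\<eta> > 0" and "\<forall>i. measure lborel (W i) = \<eta> * v $ i"
    and "\<forall>y. C y = lim (\<lambda>n. \<beta> ^ n *\<^sub>R internal_cocycle star T R n y)"
    and "\<forall>y. f y = (\<chi> i. inverse_fourier (indicator (W i)) y)"
  shows "\<forall>y. (\<lambda>n. \<beta> ^ n *\<^sub>R internal_cocycle star T R n y) \<longlonglongrightarrow> C y \<and>
             rank (C y) \<le> 1 \<and>
             (\<exists>c :: complex^'n.
                C y = (\<chi> i j. c $ i * complex_of_real (u $ j)) \<and>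
                f y = complex_of_real \<eta> *s c \<and>
                c = C y *v complexify_vec v)"
proof (intro allI)
  fix y :: "real^'k"
  have \<eta>: "\<eta> > 0" and v: "\<And>i. v $ i > 0" and u: "\<And>i. u $ i > 0" using assms(27,7,9) by auto
  have deg: "degree (min_poly lam) = r + 2 * s" using assms(5,19) by simp
  define wt where "wt a = cmod (conjugate \<kappa> \<sigma> lam (lab a))" for a
  have lab_in: "lab a \<in> coord_labels r s" for a
    using assms(20) by (auto simp: bij_betw_def)
  note conj = pv_unit_conjugates[OF assms(18,4) deg]
  have wt: "wt a > 0" "wt a < 1" for a
    using conj(2,3)[OF lab_in] by (simp_all add: wt_def)
  have QQ: "Q ** transpose Q = (\<chi> a b. if a = b then (wt a)\<^sup>2 else 0)"
    unfolding wt_def assms(22) by (rule star_matrix_mult_transpose[OF assms(20)])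
  have \<beta>Q: "\<beta> = \<bar>det Q\<bar>" using assms(23,24) by (simp add: det_transpose)
  have \<beta>wt: "\<beta> = (\<Prod>a\<in>UNIV. wt a)"
    unfolding \<beta>Q by (rule abs_det_orthogonal_rows[OF QQ wt(1)])
  have \<beta>: "\<beta> > 0" unfolding \<beta>wt using wt by (intro prod_pos) auto
  \<comment> \<open>Along \<open>lab\<close>, \<beta> is the product of the moduli of the conjugates
    other than \<open>lam\<close>, so this is the norm bound for a unit.\<close>
  have le: "lam * \<beta> \<le> 1"
    using conj(1) prod.reindex_bij_betw[OF assms(20), of "\<lambda>l. cmod (conjugate \<kappa> \<sigma> lam l)"]
    by (simp add: \<beta>wt wt_def)
  have card: "real (card (T i j)) = M $ i $ j" for i j
    unfolding assms(2,17) using assms(13,14) u by (simp add: card_displacements subst_matrix_def)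
  have fin: "finite (T i j)" for i j by (simp add: assms(17) finite_displacements)
  have W: "compact (W i)" for i using assms(25) by blast
  have Weq: "W i = (\<Union>j. \<Union>t\<in>T i j. (\<lambda>x. Q *v x + star t) ` W j)" for i
    using assms(26) by blast
  have vol: "measure lborel (W i) = \<eta> * v $ i" for i using assms(28) by blast
  have Mv: "(\<Sum>j\<in>UNIV. real (card (T i j)) * v $ j) = lam * v $ i" for i
    using assms(8) unfolding card by (simp only: vec_eq_iff matrix_vector_mult_def vec_lambda_beta vector_smult_component)
  have sum: "(\<Sum>j\<in>UNIV. real (card (T i j)) * measure lborel (W j)) = lam * (\<eta> * v $ i)" for i
    using Mv[of i] by (simp add: vol mult.left_commute flip: sum_distrib_left)
  \<comment> \<open>Volumes in the window equation give the opposite inequality, after cancelling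
    the positive volume of one window.\<close>
  have "\<eta> * v $ i \<le> \<beta> * (lam * (\<eta> * v $ i))" for i
    using measure_affine_union_le[where W = W and T = "T i" and star = star, OF QQ wt(1) W fin] unfolding \<beta>Q sum
    by (simp only: Weq[symmetric] vol)
  from this[of undefined] have "1 * (\<eta> * v $ undefined) \<le> (lam * \<beta>) * (\<eta> * v $ undefined)"
    by (simp add: mult_ac)
  then have "1 \<le> lam * \<beta>" using \<eta> v[of undefined] by (simp only: mult_le_cancel_right_pos mult_pos_pos)
  with le have \<beta>lam: "\<beta> * lam = 1" by (simp add: mult.commute)
  have Mv': "\<beta> * (\<Sum>j\<in>UNIV. real (card (T i j)) * v $ j) = v $ i" for i
    using \<beta>lam unfolding Mv by (simp add: mult.assoc[symmetric])
  \<comment> \<open>Because \<open>\<beta> * lam = 1\<close>, the volume estimate is sharp and the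
    transforms of the pieces simply add up.\<close>
  have f_eq: "f z $ i = \<beta> *\<^sub>R (\<Sum>j\<in>UNIV. internal_fourier_matrix star T z $ i $ j * f (R *v z) $ j)" for z i
  proof -
    have "measure lborel (\<Union>j. \<Union>t\<in>T i j. (\<lambda>x. Q *v x + star t) ` W j)
       = \<bar>det Q\<bar> * (\<Sum>j\<in>UNIV. real (card (T i j)) * measure lborel (W j))"
      unfolding sum unfolding Weq[symmetric] vol \<beta>Q[symmetric] using \<beta>lam by (simp add: mult.assoc[symmetric])
    from inverse_fourier_affine_union[where W = W and T = "T i" and star = star, OF QQ wt(1) W fin this, of z] show ?thesis
      unfolding Weq[symmetric] \<beta>Q[symmetric] assms(23)[symmetric]
      using assms(30) by (simp add: internal_fourier_matrix_def)
  qed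
  have R: "(\<lambda>n. ((*v) R ^^ n) y) \<longlonglongrightarrow> 0"
    using transpose_orthogonal_rows_funpow_tendsto_0[OF QQ] wt assms(23) by (simp add: less_imp_le)
  have lim: "(\<lambda>n. f (((*v) R ^^ n) y) $ j) \<longlonglongrightarrow> complex_of_real (\<eta> * v $ j)" for j
    using inverse_fourier_indicator_tendsto_0[OF W[of j] R] assms(30) by (simp add: vol)
  \<comment> \<open>The only vector compatible with the claimed relation between \<open>f y\<close>
    and \<eta>.\<close>
  define c where "c = complex_of_real (1 / \<eta>) *s f y"
  have c_lim: "(\<lambda>n. (\<beta> ^ n *\<^sub>R internal_cocycle star T R n y) *v complexify_vec v) \<longlonglongrightarrow> c"
    unfolding c_def by (rule scaled_cocycle_fixed_vector_tendsto[OF \<beta> v \<eta> Mv' f_eq lim])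
  obtain k where k: "\<And>i j. i \<in> set ((subst_word \<rho> ^^ k) [j])"
    using assms(1) by (auto simp: primitive_subst_def)
  have M: "(\<chi> i j. real (card (T i j))) = M" by (simp only: card vec_lambda_eta vec_nth_inverse)
  have "\<And>i j. matrix_power M k $ i $ j > 0"
    unfolding assms(2) using k by (simp add: matrix_power_subst_matrix count_list_0_iff zero_less_iff_neq_zero)
  moreover have "\<beta> *\<^sub>R (M *v v) = v" "\<beta> *\<^sub>R (u v* M) = u"
    unfolding assms(8,10) using \<beta>lam by (simp_all add: vec_eq_iff mult.assoc[symmetric])
  ultimately have lim_P: "(\<lambda>n. \<beta> ^ n *\<^sub>R internal_cocycle star T R n y) \<longlonglongrightarrow>
      (\<chi> i j. c $ i * complex_of_real (u $ j))"
    using internal_cocycle_tendsto_rank_one[OF \<beta> v u assms(12) _ _ _ R c_lim] unfolding M by blast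
  then have C: "C y = (\<chi> i j. c $ i * complex_of_real (u $ j))"
    unfolding assms(29)[rule_format] by (rule limI)
  have rank: "rank (C y) \<le> 1"
    using rank_outer_product_le_1[of c "complexify_vec u"] by (simp add: C complexify_vec_def)
  \<comment> \<open>The outer product applied to \<open>v\<close> returns \<open>c\<close> because
    of the normalisation of \<open>u\<close> against \<open>v\<close>.\<close>
  have c: "c = C y *v complexify_vec v"
  proof -
    have "complex_of_real (\<Sum>j\<in>UNIV. u $ j * v $ j) = 1" using assms(12) by simp
    then show ?thesis
      by (simp add: C vec_eq_iff matrix_vector_mult_def complexify_vec_def mult.assoc flip: sum_distrib_left)
  qed
  have f: "f y = complex_of_real \<eta> *s c"
    using \<eta> by (simp add: c_def vec_eq_iff)
  show "(\<lambda>n. \<beta> ^ n *\<^sub>R internal_cocycle star T R n y) \<longlonglongrightarrow> C y \<and> rank (C y) \<le> 1 \<and>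
      (\<exists>c :: complex^'n. C y = (\<chi> i j. c $ i * complex_of_real (u $ j)) \<and>
         f y = complex_of_real \<eta> *s c \<and> c = C y *v complexify_vec v)"
    using rank lim_P by (intro conjI exI[of _ c] C f c) (simp_all only: C)
qed

end
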